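(* Let $\mathbb{K}$ be an algebraically closed field of characteristic $p>0$ and let $\mathcal{C}$ be a ribbon pseudotensor category over $\mathbb{K}$ in which traces of nilpotent endomorphisms are zero, with twist $v\in\mathrm{Aut}(\mathrm{Id}_{\mathcal{C}})$ such that $v^\ell$ is unipotent for some positive integer $\ell$ coprime to $p$. Let $n$ be the smallest positive integer such that $p^n-1$ is divisible by $\ell^2$. Then for any object $V\in\mathcal{C}$ we have $\dim V\in\mathbb{F}_{p^n}\subset\mathbb{K}$.
   Context: A ribbon pseudotensor category over $\mathbb{K}$ is a $\mathbb{K}$-linear Karoubian category (finite direct sums exist and idempotents have images) with finite dimensional Hom spaces, endowed with a braided monoidal structure $(\otimes,a,\mathbbm{1},c)$ that is rigid (every object $X$ has a dual $X^*$ with $\mathrm{ev}_X:X^*\otimes X\to\mathbbm{1}$, $\mathrm{coev}_X:\mathbbm{1}\to X\otimes X^*$), with $\otimes$ bilinear on morphisms and $\mathrm{End}(\mathbbm{1})=\mathbb{K}$, and with a twist: a natural automorphism $v$ of the identity functor such that $v_{X\otimes Y}=(v_X\otimes v_Y)\circ c_{Y,X}\circ c_{X,Y}$ and $v_{X^*}=(v_X)^*$ for all $X,Y$. The trace of an endomorphism $f:X\to X$ is the element of $\mathrm{End}(\mathbbm{1})=\mathbb{K}$ given by $\mathrm{Tr}(f)=\mathrm{ev}_X\circ c_{X,X^*}\circ\big((v_X\circ f)\otimes 1_{X^*}\big)\circ\mathrm{coev}_X$, and $\dim X:=\mathrm{Tr}(1_X)$. $v^\ell$ unipotent means that $v_X^\ell-1_X$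 is nilpotent for every object $X$. *)

theory Defs
  imports "HOL-Computational_Algebra.Computational_Algebra"
begin

section \<open>Finite subfields of an algebraically closed field\<close>

definition is_subfield :: "'k::field set \<Rightarrow> bool" where
  "is_subfield F \<longleftrightarrow> 0 \<in> F \<and> 1 \<in> F \<and>
     (\<forall>x\<in>F. \<forall>y\<in>F. x - y \<in> F \<and> x * y \<in> F) \<and> (\<forall>x\<in>F. inverse x \<in> F)"

text \<open>The field \<open>\<bbbF>\<^sub>q\<close> viewed inside \<open>\<bbbK>\<close>. The description is proper for
  \<open>\<bbbK>\<close> algebraically closed of characteristic \<open>p > 0\<close> and \<open>q = p ^ n\<close>, \<open>n > 0\<close>;
  see \<open>ex1_finite_subfield\<close> below.\<close>

definition finite_subfield :: "nat \<Rightarrow> 'k::field set" where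
  "finite_subfield q = (THE F. is_subfield F \<and> card F = q)"

lemma is_subfield_frobenius_fixed:
  assumes "CHAR('k::field) = p" "p > 0"
  shows "is_subfield {x::'k. x ^ (p ^ n) = x}"
proof -
  have p: "prime p" using assms prime_CHAR_semidom[where ?'a='k] by simp
  have add: "(x + y :: 'k) ^ (p ^ n) = x ^ (p ^ n) + y ^ (p ^ n)" for x y
    by (rule freshmans_dream'[where n = n]) (use assms p in auto)
  have "(x - y) ^ (p ^ n) + y ^ (p ^ n) = x ^ (p ^ n)" for x y :: 'k
    using add[of "x - y" y] by simp
  hence diff: "(x - y) ^ (p ^ n) = x ^ (p ^ n) - y ^ (p ^ n)" for x y :: 'k
    by (simp add: eq_diff_eq)
  show ?thesis
    using assms by (auto simp: is_subfield_def diff power_mult_distrib power_inverse)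
qed

lemma card_frobenius_fixed:
  assumes "CHAR('k::alg_closed_field) = p" "p > 0" "n > 0"
  shows "card {x::'k. x ^ (p ^ n) = x} = p ^ n"
proof -
  have "prime p" using assms prime_CHAR_semidom[where ?'a='k] by simp
  hence "p \<ge> 2" by (rule prime_ge_2_nat)
  define q where "q = p ^ n"
  have "q \<ge> 2"
    using \<open>p \<ge> 2\<close> \<open>n > 0\<close> self_le_power[of p n] unfolding q_def by linarith
  have q0: "of_nat q = (0::'k)"
    using assms by (simp add: q_def of_nat_eq_0_iff_char_dvd)
  define f :: "'k poly" where "f = monom 1 q - monom 1 1"
  have deg: "degree f = q"
  proof (rule antisym)
    show "degree f \<le> q"
      unfolding f_def using \<open>q \<ge> 2\<close>
      by (intro degree_diff_le) (auto simp: degree_monom_eq)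
    show "q \<le> degree f"
      using \<open>q \<ge> 2\<close> by (intro le_degree) (simp add: f_def)
  qed
  have "f \<noteq> 0" using deg \<open>q \<ge> 2\<close> by auto
  have root: "poly f x = 0 \<longleftrightarrow> x ^ q = x" for x
    by (simp add: f_def poly_monom)
  have der: "pderiv f = -1"
    unfolding f_def using q0 by (simp add: pderiv_diff pderiv_monom)
  obtain A where A: "size A = degree f" "f = smult (lead_coeff f) (\<Prod>x\<in>#A. [:-x, 1:])"
    using alg_closed_imp_factorization[OF \<open>f \<noteq> 0\<close>] by blast
  have "count A a \<le> 1" for a
  proof (rule ccontr)
    assume "\<not> count A a \<le> 1"
    hence "{#a, a#} \<subseteq># A"
      by (auto simp: subseteq_mset_def)
    then obtain B where B: "A = {#a, a#} + B"
      by (meson mset_subset_eq_exists_conv)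
    obtain r where "f = [:-a, 1:] * ([:-a, 1:] * r)"
      using A(2) unfolding B by (metis (no_types, lifting) image_mset_add_mset image_mset_union
          add_mset_add_single mult_smult_right prod_mset.add_mset union_mset_add_mset_left
          add_0 )
    hence "poly (pderiv f) a = 0"
      by (simp only: pderiv_mult poly_add poly_mult) simp
    thus False by (simp add: der)
  qed
  hence "A = mset_set (set_mset A)"
    by (intro multiset_eqI)
       (metis count_eq_zero_iff count_mset_set(1) count_mset_set(3) finite_set_mset
         le_antisym not_gr_zero One_nat_def Suc_leI)
  hence "card (set_mset A) = q"
    using A(1) deg by (metis size_mset_set)
  moreover have "set_mset A = {x. x ^ q = x}"
  proof -
    have "poly f x = 0 \<longleftrightarrow> x \<in># A" for x
      using \<open>f \<noteq> 0\<close> by (subst A(2)) (auto simp: poly_prod_mset prod_mset_zero_iff)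
    thus ?thesis using root by auto
  qed
  ultimately show ?thesis by (simp add: q_def)
qed

lemma subfield_power_card:
  assumes "is_subfield F" "card F = q" "q > 0" "x \<in> F"
  shows "x ^ q = (x::'k::field)"
proof (cases "x = 0")
  case True
  thus ?thesis using assms by simp
next
  case False
  have fin: "finite F" using assms card_ge_0_finite by auto
  have z: "0 \<in> F" using assms by (simp add: is_subfield_def)
  have "(\<Prod>y\<in>F-{0}. x * y) = (\<Prod>y\<in>F-{0}. y)"
    by (rule prod.reindex_bij_witness[of _ "\<lambda>y. inverse x * y" "\<lambda>y. x * y"])
       (use False assms in \<open>auto simp: is_subfield_def\<close>)
  hence "x ^ card (F - {0}) * \<Prod>(F - {0}) = \<Prod>(F - {0})"
    by (simp add: prod.distrib)
  hence "x ^ (q - 1) = 1" using fin z assms by simp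
  thus ?thesis using \<open>q > 0\<close> by (metis Suc_diff_1 mult.right_neutral power_Suc)
qed

lemma subfield_card_unique:
  assumes "CHAR('k::alg_closed_field) = p" "p > 0" "n > 0"
    and "is_subfield F" "card F = p ^ n"
  shows "F = {x::'k. x ^ (p ^ n) = x}"
proof (rule card_subset_eq)
  show "finite {x::'k. x ^ (p ^ n) = x}"
    using card_frobenius_fixed[OF assms(1-3)] assms(2) card_ge_0_finite by force
  show "F \<subseteq> {x::'k. x ^ (p ^ n) = x}"
    using subfield_power_card[OF assms(4,5)] assms(2) by auto
qed (use card_frobenius_fixed[OF assms(1-3)] assms(5) in simp)

lemma ex1_finite_subfield:
  assumes "CHAR('k::alg_closed_field) = p" "p > 0" "n > 0"
  shows "\<exists>!F :: 'k set. is_subfield F \<and> card F = p ^ n"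
  using is_subfield_frobenius_fixed[OF assms(1,2)] card_frobenius_fixed[OF assms]
    subfield_card_unique[OF assms] by blast

lemma finite_subfield_eq:
  assumes "CHAR('k::alg_closed_field) = p" "p > 0" "n > 0"
  shows "finite_subfield (p ^ n) = {x::'k. x ^ (p ^ n) = x}"
  unfolding finite_subfield_def
  using theI'[OF ex1_finite_subfield[OF assms]] subfield_card_unique[OF assms] by blast


section \<open>Linear Karoubian categories\<close>

text \<open>
  Objects are the elements of the type \<open>'o\<close>. All Hom spaces are linear subspaces of one ambient
  vector space \<open>'m\<close>, so that the library's notions of subspace and span apply; every
  \<open>\<bbbK>\<close>-linear category has this form, with \<open>'m\<close> the direct sum of all its Hom spaces.
  Hom spaces therefore share \<open>0\<close> and are not assumed disjoint. The operations on morphisms are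
  constrained only on morphisms of the appropriate types.
\<close>

record ('o, 'm, 'k) linear_category =
  Hom :: "'o \<Rightarrow> 'o \<Rightarrow> 'm set"
  idm :: "'o \<Rightarrow> 'm"
  comp_mor :: "'m \<Rightarrow> 'm \<Rightarrow> 'm"  (infixr "\<cdot>\<index>" 65)
  scale :: "'k \<Rightarrow> 'm \<Rightarrow> 'm"

definition inverse_pair :: "('o, 'm, 'k, 'e) linear_category_scheme \<Rightarrow> 'o \<Rightarrow> 'o \<Rightarrow> 'm \<Rightarrow> 'm \<Rightarrow> bool"
  where "inverse_pair C X Y f g \<longleftrightarrow> f \<in> Hom C X Y \<and> g \<in> Hom C Y X \<and>
    g \<cdot>\<^bsub>C\<^esub> f = idm C X \<and> f \<cdot>\<^bsub>C\<^esub> g = idm C Y"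

definition iso :: "('o, 'm, 'k, 'e) linear_category_scheme \<Rightarrow> 'o \<Rightarrow> 'o \<Rightarrow> 'm \<Rightarrow> bool"
  where "iso C X Y f \<longleftrightarrow> (\<exists>g. inverse_pair C X Y f g)"

definition inv_mor :: "('o, 'm, 'k, 'e) linear_category_scheme \<Rightarrow> 'o \<Rightarrow> 'o \<Rightarrow> 'm \<Rightarrow> 'm"
  where "inv_mor C X Y f = (THE g. inverse_pair C X Y f g)"

primrec mor_pow :: "('o, 'm, 'k, 'e) linear_category_scheme \<Rightarrow> 'o \<Rightarrow> 'm \<Rightarrow> nat \<Rightarrow> 'm" where
  "mor_pow C X f 0 = idm C X"
| "mor_pow C X f (Suc n) = f \<cdot>\<^bsub>C\<^esub> mor_pow C X f n"

definition nilpotent :: "('o, 'm::zero, 'k, 'e) linear_category_scheme \<Rightarrow> 'o \<Rightarrow> 'm \<Rightarrow> bool" where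
  "nilpotent C X f \<longleftrightarrow> f \<in> Hom C X X \<and> (\<exists>n. mor_pow C X f n = 0)"

definition unipotent :: "('o, 'm::ab_group_add, 'k, 'e) linear_category_scheme \<Rightarrow> 'o \<Rightarrow> 'm \<Rightarrow> bool"
  where "unipotent C X f \<longleftrightarrow> nilpotent C X (f - idm C X)"

locale linear_category =
  fixes C :: "('o, 'm::ab_group_add, 'k::field, 'e) linear_category_scheme" (structure)
  assumes id_in_Hom: "idm C X \<in> Hom C X X"
    and comp_in_Hom: "\<lbrakk>f \<in> Hom C X Y; g \<in> Hom C Y Z\<rbrakk> \<Longrightarrow> g \<cdot> f \<in> Hom C X Z"
    and comp_id_left: "f \<in> Hom C X Y \<Longrightarrow> idm C Y \<cdot> f = f"
    and comp_id_right: "f \<in> Hom C X Y \<Longrightarrow> f \<cdot> idm C X = f"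
    and comp_assoc: "\<lbrakk>f \<in> Hom C X Y; g \<in> Hom C Y Z; h \<in> Hom C Z W\<rbrakk> \<Longrightarrow> (h \<cdot> g) \<cdot> f = h \<cdot> (g \<cdot> f)"
    and vector_space_scale: "vector_space (scale C)"
    and subspace_Hom: "module.subspace (scale C) (Hom C X Y)"
    and comp_add_left: "\<lbrakk>f \<in> Hom C X Y; g \<in> Hom C Y Z; g' \<in> Hom C Y Z\<rbrakk> \<Longrightarrow> (g + g') \<cdot> f = (g \<cdot> f) + (g' \<cdot> f)"
    and comp_add_right: "\<lbrakk>f \<in> Hom C X Y; f' \<in> Hom C X Y; g \<in> Hom C Y Z\<rbrakk> \<Longrightarrow> g \<cdot> (f + f') = (g \<cdot> f) + (g \<cdot> f')"
    and comp_scale_left: "\<lbrakk>f \<in> Hom C X Y; g \<in> Hom C Y Z\<rbrakk> \<Longrightarrow> scale C k g \<cdot> f = scale C k (g \<cdot> f)"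
    and comp_scale_right: "\<lbrakk>f \<in> Hom C X Y; g \<in> Hom C Y Z\<rbrakk> \<Longrightarrow> g \<cdot> scale C k f = scale C k (g \<cdot> f)"

definition direct_sum ::
  "('o, 'm::ab_group_add, 'k, 'e) linear_category_scheme \<Rightarrow> nat \<Rightarrow> (nat \<Rightarrow> 'o) \<Rightarrow>
     'o \<Rightarrow> (nat \<Rightarrow> 'm) \<Rightarrow> (nat \<Rightarrow> 'm) \<Rightarrow> bool" where
  "direct_sum C n X S inc pr \<longleftrightarrow>
     (\<forall>i<n. inc i \<in> Hom C (X i) S \<and> pr i \<in> Hom C S (X i)) \<and>
     (\<forall>i<n. \<forall>j<n. pr i \<cdot>\<^bsub>C\<^esub> inc j = (if i = j then idm C (X i) else 0)) \<and>
     (\<Sum>i<n. inc i \<cdot>\<^bsub>C\<^esub> pr i) = idm C S"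

text \<open>The empty family (\<open>n = 0\<close>) yields a zero object.\<close>

locale karoubian_category = linear_category +
  assumes finite_direct_sums: "\<exists>S inc pr. direct_sum C n F S inc pr"
    and idempotents_split: "\<lbrakk>e \<in> Hom C X X; e \<cdot> e = e\<rbrakk> \<Longrightarrow>
      \<exists>Y i r. i \<in> Hom C Y X \<and> r \<in> Hom C X Y \<and> r \<cdot> i = idm C Y \<and> i \<cdot> r = e"


section \<open>Braided, rigid and ribbon structures\<close>

text \<open>Monoidal structures are not assumed strict: \<open>assoc C X Y Z : (X \<otimes> Y) \<otimes> Z \<rightarrow> X \<otimes> (Y \<otimes> Z)\<close>,
  \<open>lunit C X : \<one> \<otimes> X \<rightarrow> X\<close>, \<open>runit C X : X \<otimes> \<one> \<rightarrow> X\<close>.\<close>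

record ('o, 'm, 'k) monoidal_category = "('o, 'm, 'k) linear_category" +
  tensor :: "'o \<Rightarrow> 'o \<Rightarrow> 'o"  (infixl "\<otimes>\<index>" 70)
  tensor_mor :: "'m \<Rightarrow> 'm \<Rightarrow> 'm"  (infixl "\<otimes>\<^sub>m\<index>" 70)
  unit_obj :: 'o
  assoc :: "'o \<Rightarrow> 'o \<Rightarrow> 'o \<Rightarrow> 'm"
  lunit :: "'o \<Rightarrow> 'm"
  runit :: "'o \<Rightarrow> 'm"

record ('o, 'm, 'k) ribbon_category = "('o, 'm, 'k) monoidal_category" +
  braid :: "'o \<Rightarrow> 'o \<Rightarrow> 'm"
  dual :: "'o \<Rightarrow> 'o"
  ev :: "'o \<Rightarrow> 'm"
  coev :: "'o \<Rightarrow> 'm"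
  twist :: "'o \<Rightarrow> 'm"

locale monoidal_linear_category = linear_category C
  for C :: "('o, 'm::ab_group_add, 'k::field, 'e) monoidal_category_scheme" (structure) +
  assumes tensor_in_Hom: "\<lbrakk>f \<in> Hom C X X'; g \<in> Hom C Y Y'\<rbrakk> \<Longrightarrow> f \<otimes>\<^sub>m g \<in> Hom C (X \<otimes> Y) (X' \<otimes> Y')"
    and tensor_id: "idm C X \<otimes>\<^sub>m idm C Y = idm C (X \<otimes> Y)"
    and tensor_comp: "\<lbrakk>f \<in> Hom C X X'; f' \<in> Hom C X' X''; g \<in> Hom C Y Y'; g' \<in> Hom C Y' Y''\<rbrakk> \<Longrightarrow>
      (f' \<cdot> f) \<otimes>\<^sub>m (g' \<cdot> g) = (f' \<otimes>\<^sub>m g') \<cdot> (f \<otimes>\<^sub>m g)"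
    and tensor_add_left: "\<lbrakk>f \<in> Hom C X X'; f' \<in> Hom C X X'; g \<in> Hom C Y Y'\<rbrakk> \<Longrightarrow>
      (f + f') \<otimes>\<^sub>m g = (f \<otimes>\<^sub>m g) + (f' \<otimes>\<^sub>m g)"
    and tensor_add_right: "\<lbrakk>f \<in> Hom C X X'; g \<in> Hom C Y Y'; g' \<in> Hom C Y Y'\<rbrakk> \<Longrightarrow>
      f \<otimes>\<^sub>m (g + g') = (f \<otimes>\<^sub>m g) + (f \<otimes>\<^sub>m g')"
    and tensor_scale_left: "\<lbrakk>f \<in> Hom C X X'; g \<in> Hom C Y Y'\<rbrakk> \<Longrightarrow>
      scale C k f \<otimes>\<^sub>m g = scale C k (f \<otimes>\<^sub>m g)"
    and tensor_scale_right: "\<lbrakk>f \<in> Hom C X X'; g \<in> Hom C Y Y'\<rbrakk> \<Longrightarrow>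
      f \<otimes>\<^sub>m scale C k g = scale C k (f \<otimes>\<^sub>m g)"
    and assoc_iso: "iso C ((X \<otimes> Y) \<otimes> Z) (X \<otimes> (Y \<otimes> Z)) (assoc C X Y Z)"
    and assoc_natural: "\<lbrakk>f \<in> Hom C X X'; g \<in> Hom C Y Y'; h \<in> Hom C Z Z'\<rbrakk> \<Longrightarrow>
      assoc C X' Y' Z' \<cdot> ((f \<otimes>\<^sub>m g) \<otimes>\<^sub>m h) = (f \<otimes>\<^sub>m (g \<otimes>\<^sub>m h)) \<cdot> assoc C X Y Z"
    and lunit_iso: "iso C (unit_obj C \<otimes> X) X (lunit C X)"
    and lunit_natural: "f \<in> Hom C X Y \<Longrightarrow> lunit C Y \<cdot> (idm C (unit_obj C) \<otimes>\<^sub>m f) = f \<cdot> lunit C X"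
    and runit_iso: "iso C (X \<otimes> unit_obj C) X (runit C X)"
    and runit_natural: "f \<in> Hom C X Y \<Longrightarrow> runit C Y \<cdot> (f \<otimes>\<^sub>m idm C (unit_obj C)) = f \<cdot> runit C X"
    and pentagon:
      "(idm C X \<otimes>\<^sub>m assoc C Y Z W) \<cdot> assoc C X (Y \<otimes> Z) W \<cdot> (assoc C X Y Z \<otimes>\<^sub>m idm C W) =
       assoc C X Y (Z \<otimes> W) \<cdot> assoc C (X \<otimes> Y) Z W"
    and triangle:
      "(idm C X \<otimes>\<^sub>m lunit C Y) \<cdot> assoc C X (unit_obj C) Y = runit C X \<otimes>\<^sub>m idm C Y"

abbreviation assoc_inv ::
  "('o, 'm, 'k, 'e) monoidal_category_scheme \<Rightarrow> 'o \<Rightarrow> 'o \<Rightarrow> 'o \<Rightarrow> 'm" where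
  "assoc_inv C X Y Z \<equiv>
     inv_mor C ((X \<otimes>\<^bsub>C\<^esub> Y) \<otimes>\<^bsub>C\<^esub> Z) (X \<otimes>\<^bsub>C\<^esub> (Y \<otimes>\<^bsub>C\<^esub> Z)) (assoc C X Y Z)"

locale braided_linear_category = monoidal_linear_category C
  for C :: "('o, 'm::ab_group_add, 'k::field, 'e) ribbon_category_scheme" (structure) +
  assumes braid_iso: "iso C (X \<otimes> Y) (Y \<otimes> X) (braid C X Y)"
    and braid_natural: "\<lbrakk>f \<in> Hom C X X'; g \<in> Hom C Y Y'\<rbrakk> \<Longrightarrow>
      braid C X' Y' \<cdot> (f \<otimes>\<^sub>m g) = (g \<otimes>\<^sub>m f) \<cdot> braid C X Y"
    and hexagon1:
      "assoc C Y Z X \<cdot> braid C X (Y \<otimes> Z) \<cdot> assoc C X Y Z =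
       (idm C Y \<otimes>\<^sub>m braid C X Z) \<cdot> assoc C Y X Z \<cdot> (braid C X Y \<otimes>\<^sub>m idm C Z)"
    and hexagon2:
      "assoc_inv C Z X Y \<cdot> braid C (X \<otimes> Y) Z \<cdot> assoc_inv C X Y Z =
       (braid C X Z \<otimes>\<^sub>m idm C Y) \<cdot> assoc_inv C X Z Y \<cdot> (idm C X \<otimes>\<^sub>m braid C Y Z)"

text \<open>The transpose \<open>f\<^sup>* : Y\<^sup>* \<rightarrow> X\<^sup>*\<close> of \<open>f : X \<rightarrow> Y\<close> is the composite
  \<open>Y\<^sup>* \<rightarrow> Y\<^sup>* \<otimes> \<one> \<rightarrow> Y\<^sup>* \<otimes> (X \<otimes> X\<^sup>*) \<rightarrow> (Y\<^sup>* \<otimes> X) \<otimes> X\<^sup>* \<rightarrow> (Y\<^sup>* \<otimes> Y) \<otimes> X\<^sup>* \<rightarrow> \<one> \<otimes> X\<^sup>* \<rightarrow> X\<^sup>*\<close>.\<close>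

definition dual_mor :: "('o, 'm, 'k, 'e) ribbon_category_scheme \<Rightarrow> 'o \<Rightarrow> 'o \<Rightarrow> 'm \<Rightarrow> 'm" where
  "dual_mor C X Y f =
     lunit C (dual C X)
     \<cdot>\<^bsub>C\<^esub> (ev C Y \<otimes>\<^sub>m\<^bsub>C\<^esub> idm C (dual C X))
     \<cdot>\<^bsub>C\<^esub> ((idm C (dual C Y) \<otimes>\<^sub>m\<^bsub>C\<^esub> f) \<otimes>\<^sub>m\<^bsub>C\<^esub> idm C (dual C X))
     \<cdot>\<^bsub>C\<^esub> assoc_inv C (dual C Y) X (dual C X)
     \<cdot>\<^bsub>C\<^esub> (idm C (dual C Y) \<otimes>\<^sub>m\<^bsub>C\<^esub> coev C X)
     \<cdot>\<^bsub>C\<^esub> inv_mor C (dual C Y \<otimes>\<^bsub>C\<^esub> unit_obj C) (dual C Y) (runit C (dual C Y))"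

text \<open>Rigidity is given by a choice of dual, evaluation and coevaluation for every object.
  The axiom \<open>End_unit\<close> says that \<open>k \<mapsto> k \<cdot> 1\<close> is an isomorphism \<open>\<bbbK> \<rightarrow> End(\<one>)\<close>.\<close>

locale ribbon_pseudotensor_category = karoubian_category C + braided_linear_category C
  for C :: "('o, 'm::ab_group_add, 'k::field, 'e) ribbon_category_scheme" (structure) +
  assumes Hom_finite_dim: "\<exists>B. finite B \<and> Hom C X Y = module.span (scale C) B"
    and End_unit: "bij_betw (\<lambda>k. scale C k (idm C (unit_obj C))) UNIV (Hom C (unit_obj C) (unit_obj C))"
    and ev_in_Hom: "ev C X \<in> Hom C (dual C X \<otimes> X) (unit_obj C)"
    and coev_in_Hom: "coev C X \<in> Hom C (unit_obj C) (X \<otimes> dual C X)"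
    and zigzag1:
      "runit C X \<cdot> (idm C X \<otimes>\<^sub>m ev C X) \<cdot> assoc C X (dual C X) X \<cdot> (coev C X \<otimes>\<^sub>m idm C X) =
       lunit C X"
    and zigzag2:
      "lunit C (dual C X) \<cdot> (ev C X \<otimes>\<^sub>m idm C (dual C X)) \<cdot> assoc_inv C (dual C X) X (dual C X)
         \<cdot> (idm C (dual C X) \<otimes>\<^sub>m coev C X) =
       runit C (dual C X)"
    and twist_iso: "iso C X X (twist C X)"
    and twist_natural: "f \<in> Hom C X Y \<Longrightarrow> twist C Y \<cdot> f = f \<cdot> twist C X"
    and twist_tensor:
      "twist C (X \<otimes> Y) = (twist C X \<otimes>\<^sub>m twist C Y) \<cdot> braid C Y X \<cdot> braid C X Y"
    and twist_dual: "twist C (dual C X) = dual_mor C X X (twist C X)"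

definition scalar_of :: "('o, 'm, 'k, 'e) monoidal_category_scheme \<Rightarrow> 'm \<Rightarrow> 'k" where
  "scalar_of C f = (THE k. scale C k (idm C (unit_obj C)) = f)"

definition cat_trace :: "('o, 'm, 'k, 'e) ribbon_category_scheme \<Rightarrow> 'o \<Rightarrow> 'm \<Rightarrow> 'k" where
  "cat_trace C X f = scalar_of C
     (ev C X \<cdot>\<^bsub>C\<^esub> braid C X (dual C X)
      \<cdot>\<^bsub>C\<^esub> ((twist C X \<cdot>\<^bsub>C\<^esub> f) \<otimes>\<^sub>m\<^bsub>C\<^esub> idm C (dual C X)) \<cdot>\<^bsub>C\<^esub> coev C X)"

definition cat_dim :: "('o, 'm, 'k, 'e) ribbon_category_scheme \<Rightarrow> 'o \<Rightarrow> 'k" where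
  "cat_dim C X = cat_trace C X (idm C X)"

end

(* Let m = p^n, write m - 1 = l * q with l dividing q, and put X = V^{(x)l}. Rotating the first
   tensor factor of V^{(x)m} past all the others, with a twist, gives an endomorphism g with
   g^m = v. Hence (g^l)^m = v^l is unipotent; as m is a power of p, g^l itself is unipotent, and so
   Tr(g^l) = (dim V)^m. On the other hand g^l rotates a copy of X past V (x) X (x) ... (x) X, and
   taking partial traces one copy of X at a time turns Tr(g^l) into the trace on X of d v_X^q, where
   d moves one factor V past the remaining l - 1. (Topologically, this is the identity of the
   torus knots T(m,l) and T(l,m).) Since l divides q, the central factor v_X^q is unipotent and can
   be dropped, and the closure of d is an unknot: Tr(d) = Tr(v_V^l) = dim V. So (dim V)^m = dim V.

   The calculations are carried out in a strict braided category equivalent to C, whose objects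
   are lists of objects of C. *)
theory Submission
  imports Defs
begin

section \<open>Arrows of monoidal categories and coherence\<close>

text \<open>The two factors l of l^2 are spent separately. As m = 1 mod l, V^{(x)m} consists of one
  V and q copies of X, so rotating by l factors can be read as moving a single X past everything
  else. As l also divides q, v_X^q is a power of v_X^l. Characteristic p enters through x^m - 1 = (x
  - 1)^m, which lets unipotence descend from (g^l)^m to g^l; coprimality of l and p provides an m =
  p^n of the required form.

  The identity of torus knots is one of framed knots: each strand that is closed off leaves a curl,
  whose value is a twist. The powers of v_X and v_V count these curls, and the assumption on v^l
  applies because both counts, q and l, are multiples of l.

  Even in the strict category the chosen dual of a concatenation is not the concatenation of the
  chosen duals. Before a factor can be closed alone, the trace must therefore be shown to be
  independent of the dual, and the double braiding hidden in the twist of a tensor product must be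
  cancelled against the crossings of the nested closure.\<close>

locale arrow_category =
  fixes arr :: "'a \<Rightarrow> bool" and dom cod :: "'a \<Rightarrow> 'o"
    and comp :: "'a \<Rightarrow> 'a \<Rightarrow> 'a"  (infixr "\<star>" 65)
    and ident :: "'o \<Rightarrow> 'a"
  assumes arr_comp [simp]: "arr (g \<star> f) \<longleftrightarrow> arr f \<and> arr g \<and> dom g = cod f"
    and dom_comp [simp]: "\<lbrakk>arr f; arr g; dom g = cod f\<rbrakk> \<Longrightarrow> dom (g \<star> f) = dom f"
    and cod_comp [simp]: "\<lbrakk>arr f; arr g; dom g = cod f\<rbrakk> \<Longrightarrow> cod (g \<star> f) = cod g"
    and arr_ident [simp]: "arr (ident x)"
    and dom_ident [simp]: "dom (ident x) = x"
    and cod_ident [simp]: "cod (ident x) = x"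
    and comp_ident_left [simp]: "\<lbrakk>arr f; cod f = x\<rbrakk> \<Longrightarrow> ident x \<star> f = f"
    and comp_ident_right [simp]: "\<lbrakk>arr f; dom f = x\<rbrakk> \<Longrightarrow> f \<star> ident x = f"
    and comp_assoc: "(h \<star> g) \<star> f = h \<star> (g \<star> f)"
begin

text \<open>Rewriting modulo associativity: an equation between composites becomes usable at the
  head of a longer composite bracketed to the right. No typing side conditions arise, since
  associativity is assumed for ill-typed composites too.\<close>

lemma comp_tail: "g \<star> f = h \<Longrightarrow> g \<star> (f \<star> k) = h \<star> k"
  by (metis comp_assoc)

section \<open>Isomorphisms and powers of arrows\<close>

definition inverse_arrows :: "'a \<Rightarrow> 'a \<Rightarrow> bool" where
  "inverse_arrows f g \<longleftrightarrow> arr f \<and> arr g \<and> dom g = cod f \<and> cod g = dom f \<and>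
     g \<star> f = ident (dom f) \<and> f \<star> g = ident (cod f)"

definition invertible :: "'a \<Rightarrow> bool" where
  "invertible f \<longleftrightarrow> (\<exists>g. inverse_arrows f g)"

definition inv_arr :: "'a \<Rightarrow> 'a" where
  "inv_arr f = (SOME g. inverse_arrows f g)"

lemma inverse_arrows_inv_arr: "invertible f \<Longrightarrow> inverse_arrows f (inv_arr f)"
  unfolding invertible_def inv_arr_def by (rule someI_ex)

lemma arr_if_invertible: "invertible f \<Longrightarrow> arr f"
  by (auto simp: invertible_def inverse_arrows_def)

lemma inv_arr_simps [simp]:
  assumes "invertible f"
  shows "arr (inv_arr f)" "dom (inv_arr f) = cod f" "cod (inv_arr f) = dom f"
    "inv_arr f \<star> f = ident (dom f)" "f \<star> inv_arr f = ident (cod f)"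
  using inverse_arrows_inv_arr[OF assms] by (auto simp: inverse_arrows_def)

lemma invertible_inv_arr: "invertible f \<Longrightarrow> invertible (inv_arr f)"
  using inverse_arrows_inv_arr[of f] unfolding invertible_def inverse_arrows_def by metis

lemma inv_arr_cancel [simp]:
  assumes "invertible f" "arr h"
  shows "cod h = dom f \<Longrightarrow> inv_arr f \<star> f \<star> h = h" "cod h = cod f \<Longrightarrow> f \<star> inv_arr f \<star> h = h"
  using assms by (metis comp_assoc comp_ident_left inv_arr_simps(4,5))+

lemma invertible_cancel_right:
  assumes "invertible f" "arr g" "arr h" "dom g = cod f" "dom h = cod f" "g \<star> f = h \<star> f"
  shows "g = h"
  by (metis assms comp_assoc comp_ident_right inv_arr_simps(5))

lemma invertible_cancel_left:
  assumes "invertible f" "arr g" "arr h" "cod g = dom f" "cod h = dom f" "f \<star> g = f \<star> h"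
  shows "g = h"
  by (metis assms inv_arr_cancel(1))

lemma inverse_arrows_unique:
  assumes "inverse_arrows f g" "inverse_arrows f h"
  shows "g = h"
  using assms unfolding inverse_arrows_def by (metis comp_assoc comp_ident_left comp_ident_right)

lemma inv_arr_eqI: "inverse_arrows f g \<Longrightarrow> inv_arr f = g"
  using inverse_arrows_unique inverse_arrows_inv_arr invertible_def by blast

lemma invertible_ident [simp]: "invertible (ident x)"
  unfolding invertible_def inverse_arrows_def by (rule exI[of _ "ident x"]) simp

lemma invertible_comp:
  assumes "invertible f" "invertible g" "dom g = cod f"
  shows "invertible (g \<star> f)"
proof -
  have [simp]: "arr f" "arr g" using assms arr_if_invertible by auto
  show ?thesis
    unfolding invertible_def inverse_arrows_def
    by (rule exI[of _ "inv_arr f \<star> inv_arr g"]) (use assms in \<open>simp add: comp_assoc\<close>)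
qed

primrec arr_pow :: "'a \<Rightarrow> nat \<Rightarrow> 'a" where
  "arr_pow f 0 = ident (dom f)"
| "arr_pow f (Suc k) = f \<star> arr_pow f k"

lemma arr_pow_simps [simp]:
  assumes "arr f" "cod f = dom f"
  shows "arr (arr_pow f k)" "dom (arr_pow f k) = dom f" "cod (arr_pow f k) = dom f"
  using assms by (induction k) auto

lemma arr_pow_commute:
  assumes "arr f" "cod f = dom f" "arr g" "cod g = dom f" "dom g = dom f" "f \<star> g = g \<star> f"
  shows "arr_pow f k \<star> g = g \<star> arr_pow f k"
proof (induction k)
  case 0
  then show ?case using assms by simp
next
  case (Suc k)
  then show ?case by (metis arr_pow.simps(2) assms(6) comp_assoc)
qed

lemma arr_pow_Suc2: "arr f \<Longrightarrow> cod f = dom f \<Longrightarrow> arr_pow f (Suc k) = arr_pow f k \<star> f"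
  by (simp add: arr_pow_commute)

lemma arr_pow_add: "\<lbrakk>arr f; cod f = dom f\<rbrakk> \<Longrightarrow> arr_pow f (i + j) = arr_pow f i \<star> arr_pow f j"
  by (induction i) (auto simp: comp_assoc)

lemma arr_pow_mult: "\<lbrakk>arr f; cod f = dom f\<rbrakk> \<Longrightarrow> arr_pow f (i * j) = arr_pow (arr_pow f i) j"
  by (induction j) (auto simp: arr_pow_add)

end


locale monoidal_arrows = arrow_category arr dom cod comp ident
  for arr :: "'a \<Rightarrow> bool" and dom cod :: "'a \<Rightarrow> 'o"
    and comp :: "'a \<Rightarrow> 'a \<Rightarrow> 'a"  (infixr "\<star>" 65)
    and ident :: "'o \<Rightarrow> 'a" +
  fixes tobj :: "'o \<Rightarrow> 'o \<Rightarrow> 'o"  (infixr "\<boxtimes>" 75)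
    and tens :: "'a \<Rightarrow> 'a \<Rightarrow> 'a"  (infixr "\<odot>" 75)
    and unit :: 'o
    and ass :: "'o \<Rightarrow> 'o \<Rightarrow> 'o \<Rightarrow> 'a" and lun run :: "'o \<Rightarrow> 'a"
  assumes arr_tens [simp]: "arr (f \<odot> g) \<longleftrightarrow> arr f \<and> arr g"
    and dom_tens [simp]: "\<lbrakk>arr f; arr g\<rbrakk> \<Longrightarrow> dom (f \<odot> g) = dom f \<boxtimes> dom g"
    and cod_tens [simp]: "\<lbrakk>arr f; arr g\<rbrakk> \<Longrightarrow> cod (f \<odot> g) = cod f \<boxtimes> cod g"
    and tens_ident [simp]: "ident x \<odot> ident y = ident (x \<boxtimes> y)"
    and interchange: "\<lbrakk>arr f; arr f'; arr g; arr g'; dom f' = cod f; dom g' = cod g\<rbrakk> \<Longrightarrow>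
      (f' \<odot> g') \<star> (f \<odot> g) = (f' \<star> f) \<odot> (g' \<star> g)"
    and invertible_ass [simp]: "invertible (ass x y z)"
    and dom_ass [simp]: "dom (ass x y z) = (x \<boxtimes> y) \<boxtimes> z"
    and cod_ass [simp]: "cod (ass x y z) = x \<boxtimes> (y \<boxtimes> z)"
    and invertible_lun [simp]: "invertible (lun x)"
    and dom_lun [simp]: "dom (lun x) = unit \<boxtimes> x"
    and cod_lun [simp]: "cod (lun x) = x"
    and invertible_run [simp]: "invertible (run x)"
    and dom_run [simp]: "dom (run x) = x \<boxtimes> unit"
    and cod_run [simp]: "cod (run x) = x"
    and ass_natural: "\<lbrakk>arr f; arr g; arr h\<rbrakk> \<Longrightarrow>
      ass (cod f) (cod g) (cod h) \<star> ((f \<odot> g) \<odot> h) = (f \<odot> (g \<odot> h)) \<star> ass (dom f) (dom g) (dom h)"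
    and lun_natural: "arr f \<Longrightarrow> lun (cod f) \<star> (ident unit \<odot> f) = f \<star> lun (dom f)"
    and run_natural: "arr f \<Longrightarrow> run (cod f) \<star> (f \<odot> ident unit) = f \<star> run (dom f)"
    and pentagon:
      "(ident x \<odot> ass y z w) \<star> ass x (y \<boxtimes> z) w \<star> (ass x y z \<odot> ident w) =
       ass x y (z \<boxtimes> w) \<star> ass (x \<boxtimes> y) z w"
    and triangle: "(ident x \<odot> lun y) \<star> ass x unit y = run x \<odot> ident y"
begin

lemma arr_coherence [simp]: "arr (ass x y z)" "arr (lun x)" "arr (run x)"
  by (simp_all add: arr_if_invertible)

lemma interchange_tail:
  "\<lbrakk>arr f; arr f'; arr g; arr g'; dom f' = cod f; dom g' = cod g\<rbrakk> \<Longrightarrow>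
      (f' \<odot> g') \<star> (f \<odot> g) \<star> h = ((f' \<star> f) \<odot> (g' \<star> g)) \<star> h"
  by (metis comp_assoc interchange)

lemma invertible_tens:
  assumes "invertible f" "invertible g"
  shows "invertible (f \<odot> g)"
proof -
  have [simp]: "arr f" "arr g" using assms arr_if_invertible by auto
  show ?thesis
    unfolding invertible_def inverse_arrows_def
    by (rule exI[of _ "inv_arr f \<odot> inv_arr g"]) (use assms in \<open>simp add: interchange\<close>)
qed

section \<open>Kelly's coherences for the unit\<close>

lemma lun_faithful:
  assumes "arr f" "arr g" "dom f = dom g" "cod f = cod g" "ident unit \<odot> f = ident unit \<odot> g"
  shows "f = g"
proof (rule invertible_cancel_right[of "lun (dom f)"])
  show "f \<star> lun (dom f) = g \<star> lun (dom f)"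
    using assms lun_natural[of f] lun_natural[of g] by simp
qed (use assms in auto)

lemma run_faithful:
  assumes "arr f" "arr g" "dom f = dom g" "cod f = cod g" "f \<odot> ident unit = g \<odot> ident unit"
  shows "f = g"
proof (rule invertible_cancel_right[of "run (dom f)"])
  show "f \<star> run (dom f) = g \<star> run (dom f)"
    using assms run_natural[of f] run_natural[of g] by simp
qed (use assms in auto)

text \<open>Kelly's argument: nothing is lost by tensoring with the unit, by
  \<open>lun_faithful\<close>, and afterwards the pentagon and two triangles apply.\<close>

lemma lun_tens: "lun (x \<boxtimes> y) \<star> ass unit x y = lun x \<odot> ident y"
proof (rule lun_faithful)
  \<comment> \<open>Together with \<open>ident unit \<odot> ass unit x y\<close> this forms the
    three-arrow side of the pentagon.\<close>
  let ?k = "ass unit (unit \<boxtimes> x) y \<star> (ass unit unit x \<odot> ident y)"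
  show "ident unit \<odot> (lun (x \<boxtimes> y) \<star> ass unit x y) = ident unit \<odot> (lun x \<odot> ident y)"
  proof (rule invertible_cancel_right[of ?k])
    show "invertible ?k" by (simp add: invertible_comp invertible_tens)
    have "(ident unit \<odot> (lun (x \<boxtimes> y) \<star> ass unit x y)) \<star> ?k
        = (ident unit \<odot> lun (x \<boxtimes> y)) \<star> (ident unit \<odot> ass unit x y) \<star> ?k"
      by (simp add: interchange_tail)
    also have "\<dots> = (ident unit \<odot> lun (x \<boxtimes> y)) \<star> ass unit unit (x \<boxtimes> y) \<star> ass (unit \<boxtimes> unit) x y"
      by (simp add: pentagon)
    also have "\<dots> = (run unit \<odot> (ident x \<odot> ident y)) \<star> ass (unit \<boxtimes> unit) x y"
      by (simp add: comp_tail[OF triangle])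
    also have "\<dots> = ass unit x y \<star> ((run unit \<odot> ident x) \<odot> ident y)"
      using ass_natural[of "run unit" "ident x" "ident y"] by simp
    also have "\<dots> = ass unit x y \<star> ((ident unit \<odot> lun x) \<odot> ident y) \<star> (ass unit unit x \<odot> ident y)"
      by (simp add: interchange triangle)
    also have "\<dots> = (ident unit \<odot> (lun x \<odot> ident y)) \<star> ?k"
      using comp_tail[OF ass_natural[of "ident unit" "lun x" "ident y"]] by (simp add: comp_assoc)
    finally show "(ident unit \<odot> (lun (x \<boxtimes> y) \<star> ass unit x y)) \<star> ?k
      = (ident unit \<odot> (lun x \<odot> ident y)) \<star> ?k" .
  qed simp_all
qed simp_all

text \<open>Mirror image of the previous argument: tensor with the unit on the right and compose
  with an associator on the left.\<close>

lemma run_tens: "(ident x \<odot> run y) \<star> ass x y unit = run (x \<boxtimes> y)"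
proof (rule run_faithful)
  show "((ident x \<odot> run y) \<star> ass x y unit) \<odot> ident unit = run (x \<boxtimes> y) \<odot> ident unit"
  proof (rule invertible_cancel_left[of "ass x y unit"])
    have "ass x y unit \<star> (((ident x \<odot> run y) \<star> ass x y unit) \<odot> ident unit)
      = ass x y unit \<star> ((ident x \<odot> run y) \<odot> ident unit) \<star> (ass x y unit \<odot> ident unit)"
      by (simp add: interchange)
    also have "\<dots> = (ident x \<odot> (run y \<odot> ident unit)) \<star> ass x (y \<boxtimes> unit) unit \<star> (ass x y unit \<odot> ident unit)"
      using comp_tail[OF ass_natural[of "ident x" "run y" "ident unit"]] by (simp add: comp_assoc)
    also have "\<dots> = (ident x \<odot> (ident y \<odot> lun unit)) \<star> (ident x \<odot> ass y unit unit) \<star>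
        ass x (y \<boxtimes> unit) unit \<star> (ass x y unit \<odot> ident unit)"
      by (simp add: interchange_tail triangle)
    also have "\<dots> = (ident x \<odot> (ident y \<odot> lun unit)) \<star> ass x y (unit \<boxtimes> unit) \<star> ass (x \<boxtimes> y) unit unit"
      by (simp add: pentagon)
    also have "\<dots> = ass x y unit \<star> (ident (x \<boxtimes> y) \<odot> lun unit) \<star> ass (x \<boxtimes> y) unit unit"
      using comp_tail[OF ass_natural[of "ident x" "ident y" "lun unit"]] by (simp add: comp_assoc)
    also have "\<dots> = ass x y unit \<star> (run (x \<boxtimes> y) \<odot> ident unit)"
      by (simp add: triangle)
    finally show "ass x y unit \<star> (((ident x \<odot> run y) \<star> ass x y unit) \<odot> ident unit)
      = ass x y unit \<star> (run (x \<boxtimes> y) \<odot> ident unit)" .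
  qed simp_all
qed simp_all

text \<open>Naturality of \<open>lun\<close> at \<open>lun unit\<close> itself identifies
  \<open>lun (unit \<boxtimes> unit)\<close> with \<open>ident unit \<odot> lun unit\<close>. Then
  \<open>lun_tens\<close> and \<open>triangle\<close> have the same left-hand side.\<close>

lemma lun_unit: "lun unit = run unit"
proof (rule run_faithful)
  have "lun (unit \<boxtimes> unit) = ident unit \<odot> lun unit"
    using lun_natural[of "lun unit"] by (simp add: invertible_cancel_left[of "lun unit"])
  then show "lun unit \<odot> ident unit = run unit \<odot> ident unit"
    using lun_tens[of unit unit] triangle[of unit unit] by simp
qed simp_all

text \<open>The clause for singletons makes \<open>lobj [x]\<close> equal to \<open>x\<close> rather than \<open>x \<boxtimes> unit\<close>.\<close>

fun lobj :: "'o list \<Rightarrow> 'o" where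
  "lobj [] = unit"
| "lobj [x] = x"
| "lobj (x # y # xs) = x \<boxtimes> lobj (y # xs)"

text \<open>The structure isomorphisms of \<open>lobj\<close> as a monoidal functor from lists under
  concatenation. At a singleton there is nothing to rebracket, only a possible unit to
  remove.\<close>

fun mult :: "'o list \<Rightarrow> 'o list \<Rightarrow> 'a" where
  "mult [] ys = lun (lobj ys)"
| "mult [x] [] = run x"
| "mult [x] (y # ys) = ident (x \<boxtimes> lobj (y # ys))"
| "mult (x # y # xs) zs = (ident x \<odot> mult (y # xs) zs) \<star> ass x (lobj (y # xs)) (lobj zs)"

lemma mult_simps [simp]:
  "invertible (mult xs ys)" "dom (mult xs ys) = lobj xs \<boxtimes> lobj ys" "cod (mult xs ys) = lobj (xs @ ys)"
proof (induction xs ys rule: mult.induct)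
  case (4 x y xs zs)
  note [simp] = arr_if_invertible[OF 4(1)]
  case 1 show ?case using 4 by (auto intro!: invertible_comp invertible_tens)
  case 2 show ?case using 4 by auto
  case 3 show ?case using 4 by auto
qed auto

lemma arr_mult [simp]: "arr (mult xs ys)"
  by (simp add: arr_if_invertible)

lemma mult_Nil_right: "mult xs [] = run (lobj xs)"
proof (induction xs rule: lobj.induct)
  case (3 x y xs)
  then show ?case by (simp add: run_tens)
qed (auto simp: lun_unit)

text \<open>The associativity law of the monoidal functor \<open>lobj\<close>, which takes the place
  of a general coherence theorem. The induction step is the pentagon, with naturality of the
  associator on either side of it.\<close>

lemma mult_coherence:
  "mult (xs @ ys) zs \<star> (mult xs ys \<odot> ident (lobj zs)) =
   mult xs (ys @ zs) \<star> (ident (lobj xs) \<odot> mult ys zs) \<star> ass (lobj xs) (lobj ys) (lobj zs)"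
proof (induction xs rule: lobj.induct)
  case 1
  show ?case
    using comp_tail[OF lun_natural[of "mult ys zs"]]
    by (simp add: lun_tens[symmetric] comp_assoc)
next
  case (2 x)
  show ?case
  proof (cases ys)
    case Nil
    have "mult [x] zs \<star> (run x \<odot> ident (lobj zs)) =
      mult [x] zs \<star> (ident x \<odot> lun (lobj zs)) \<star> ass x unit (lobj zs)"
      by (simp add: triangle)
    then show ?thesis using Nil by simp
  next
    case (Cons y ys')
    then show ?thesis by (simp add: mult_simps(3)[of "y # ys'" zs, simplified])
  qed
next
  case (3 x y xs)
  let ?a = "lobj (y # xs)" and ?b = "lobj ys" and ?c = "lobj zs"
  have "mult ((x # y # xs) @ ys) zs \<star> (mult (x # y # xs) ys \<odot> ident ?c)
    = (ident x \<odot> mult (y # xs @ ys) zs) \<star> ass x (lobj (y # xs @ ys)) ?c \<star>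
       ((ident x \<odot> mult (y # xs) ys) \<odot> ident ?c) \<star> (ass x ?a ?b \<odot> ident ?c)"
    by (simp add: interchange comp_assoc)
  also have "\<dots> = (ident x \<odot> mult (y # xs @ ys) zs) \<star> (ident x \<odot> (mult (y # xs) ys \<odot> ident ?c)) \<star>
       ass x (?a \<boxtimes> ?b) ?c \<star> (ass x ?a ?b \<odot> ident ?c)"
    using comp_tail[OF ass_natural[of "ident x" "mult (y # xs) ys" "ident ?c"]]
    by (simp add: comp_assoc)
  also have "\<dots> = (ident x \<odot> (mult (y # xs @ ys) zs \<star> (mult (y # xs) ys \<odot> ident ?c))) \<star>
       ass x (?a \<boxtimes> ?b) ?c \<star> (ass x ?a ?b \<odot> ident ?c)"
    by (simp add: interchange_tail)
  also have "\<dots> = (ident x \<odot> mult (y # xs) (ys @ zs)) \<star> (ident x \<odot> (ident ?a \<odot> mult ys zs)) \<star>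
       (ident x \<odot> ass ?a ?b ?c) \<star> ass x (?a \<boxtimes> ?b) ?c \<star> (ass x ?a ?b \<odot> ident ?c)"
    using 3 by (simp add: interchange_tail)
  also have "\<dots> = (ident x \<odot> mult (y # xs) (ys @ zs)) \<star> (ident x \<odot> (ident ?a \<odot> mult ys zs)) \<star>
       ass x ?a (?b \<boxtimes> ?c) \<star> ass (x \<boxtimes> ?a) ?b ?c"
    by (simp add: pentagon)
  also have "\<dots> = (ident x \<odot> mult (y # xs) (ys @ zs)) \<star> ass x ?a (lobj (ys @ zs)) \<star>
       (ident (x \<boxtimes> ?a) \<odot> mult ys zs) \<star> ass (x \<boxtimes> ?a) ?b ?c"
    using comp_tail[OF ass_natural[of "ident x" "ident ?a" "mult ys zs"]] by (simp add: comp_assoc)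
  finally show ?case by (simp add: comp_assoc)
qed

end


section \<open>Traces and rotations in strict ribbon categories\<close>

primrec lpow :: "'a list \<Rightarrow> nat \<Rightarrow> 'a list" where
  "lpow w 0 = []"
| "lpow w (Suc k) = w @ lpow w k"

lemma lpow_add: "lpow w (i + j) = lpow w i @ lpow w j"
  by (induction i) auto

lemma lpow_Suc2: "lpow w (Suc k) = lpow w k @ w"
  using lpow_add[of w k 1] by simp

text \<open>Tensor powers of one object commute as lists, not just up to isomorphism. This is what
  makes braidings between them endomorphisms, so that they have powers and traces.\<close>

lemma lpow_append_commute: "lpow w k @ w = w @ lpow w k"
  by (metis lpow.simps(2) lpow_Suc2)

lemma lpow_mult: "lpow w (i * j) = lpow (lpow w i) j"
  by (induction j) (auto simp: lpow_add)

locale strict_monoidal_arrows = arrow_category arr dom cod comp ident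
  for arr :: "'a \<Rightarrow> bool" and dom cod :: "'a \<Rightarrow> 'o list"
    and comp :: "'a \<Rightarrow> 'a \<Rightarrow> 'a"  (infixr "\<star>" 65)
    and ident :: "'o list \<Rightarrow> 'a" +
  fixes tens :: "'a \<Rightarrow> 'a \<Rightarrow> 'a"  (infixr "\<odot>" 75)
  assumes arr_tens [simp]: "arr (f \<odot> g) \<longleftrightarrow> arr f \<and> arr g"
    and dom_tens [simp]: "\<lbrakk>arr f; arr g\<rbrakk> \<Longrightarrow> dom (f \<odot> g) = dom f @ dom g"
    and cod_tens [simp]: "\<lbrakk>arr f; arr g\<rbrakk> \<Longrightarrow> cod (f \<odot> g) = cod f @ cod g"
    and tens_ident [simp]: "ident x \<odot> ident y = ident (x @ y)"
    and interchange: "\<lbrakk>arr f; arr f'; arr g; arr g'; dom f' = cod f; dom g' = cod g\<rbrakk> \<Longrightarrow>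
      (f' \<odot> g') \<star> (f \<odot> g) = (f' \<star> f) \<odot> (g' \<star> g)"
    and tens_assoc: "(f \<odot> g) \<odot> h = f \<odot> (g \<odot> h)"
    and tens_unit_left [simp]: "arr f \<Longrightarrow> ident [] \<odot> f = f"
    and tens_unit_right [simp]: "arr f \<Longrightarrow> f \<odot> ident [] = f"
begin

lemma tens_ident_tail [simp]: "ident x \<odot> ident y \<odot> f = ident (x @ y) \<odot> f"
  by (metis tens_assoc tens_ident)

lemma whisker_left:
  "\<lbrakk>arr f; arr g; dom g = cod f\<rbrakk> \<Longrightarrow> ident x \<odot> (g \<star> f) = (ident x \<odot> g) \<star> (ident x \<odot> f)"
  by (simp add: interchange)

lemma whisker_right:
  "\<lbrakk>arr f; arr g; dom g = cod f\<rbrakk> \<Longrightarrow> (g \<star> f) \<odot> ident x = (g \<odot> ident x) \<star> (f \<odot> ident x)"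
  by (simp add: interchange)

lemmas normalize = tens_assoc comp_assoc whisker_left whisker_right

lemma slide:
  "\<lbrakk>arr f; arr g; x = dom f; x' = cod f; y = dom g; y' = cod g\<rbrakk> \<Longrightarrow>
    (f \<odot> ident y') \<star> (ident x \<odot> g) = (ident x' \<odot> g) \<star> (f \<odot> ident y)"
  by (simp add: interchange)

end


locale strict_ribbon_arrows = strict_monoidal_arrows arr dom cod comp ident tens
  for arr :: "'a \<Rightarrow> bool" and dom cod :: "'a \<Rightarrow> 'o list"
    and comp :: "'a \<Rightarrow> 'a \<Rightarrow> 'a"  (infixr "\<star>" 65)
    and ident :: "'o list \<Rightarrow> 'a"
    and tens :: "'a \<Rightarrow> 'a \<Rightarrow> 'a"  (infixr "\<odot>" 75) +
  fixes br :: "'o list \<Rightarrow> 'o list \<Rightarrow> 'a"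
    and tw :: "'o list \<Rightarrow> 'a"
    and du :: "'o list \<Rightarrow> 'o list"
    and evl cvl :: "'o list \<Rightarrow> 'a"
  assumes invertible_br [simp]: "invertible (br x y)"
    and dom_br [simp]: "dom (br x y) = x @ y"
    and cod_br [simp]: "cod (br x y) = y @ x"
    and br_natural: "\<lbrakk>arr f; arr g; x = dom f; x' = cod f; y = dom g; y' = cod g\<rbrakk> \<Longrightarrow>
      br x' y' \<star> (f \<odot> g) = (g \<odot> f) \<star> br x y"
    and br_append_right: "br x (y @ z) = (ident y \<odot> br x z) \<star> (br x y \<odot> ident z)"
    and br_append_left: "br (x @ y) z = (br x z \<odot> ident y) \<star> (ident x \<odot> br y z)"
    and arr_tw [simp]: "arr (tw x)"
    and dom_tw [simp]: "dom (tw x) = x"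
    and cod_tw [simp]: "cod (tw x) = x"
    and tw_natural: "\<lbrakk>arr f; x = dom f; y = cod f\<rbrakk> \<Longrightarrow> tw y \<star> f = f \<star> tw x"
    and tw_append: "tw (x @ y) = (tw x \<odot> tw y) \<star> br y x \<star> br x y"
    and arr_evl [simp]: "arr (evl x)"
    and dom_evl [simp]: "dom (evl x) = du x @ x"
    and cod_evl [simp]: "cod (evl x) = []"
    and arr_cvl [simp]: "arr (cvl x)"
    and dom_cvl [simp]: "dom (cvl x) = []"
    and cod_cvl [simp]: "cod (cvl x) = x @ du x"
    and zigzag: "(ident x \<odot> evl x) \<star> (cvl x \<odot> ident x) = ident x"
begin

lemma arr_br [simp]: "arr (br x y)"
  by (simp add: arr_if_invertible)

text \<open>The strict hexagon with two empty lists says that this invertible arrow is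
  idempotent.\<close>

lemma br_Nil_right [simp]: "br x [] = ident x"
proof (rule invertible_cancel_left[of "br x []"])
  show "br x [] \<star> br x [] = br x [] \<star> ident x"
    using br_append_right[of x "[]" "[]"] by simp
qed simp_all

lemma br_Nil_left [simp]: "br [] x = ident x"
proof (rule invertible_cancel_left[of "br [] x"])
  show "br [] x \<star> br [] x = br [] x \<star> ident x"
    using br_append_left[of "[]" "[]" x] by simp
qed simp_all

text \<open>An evaluation on the other side, with the braiding but without the twist: naturality of
  the braiding then applies to it directly, and \<open>tr\<close> adds the twist.\<close>

definition nev :: "'o list \<Rightarrow> 'a" where
  "nev x = evl x \<star> br x (du x)"

lemma nev_simps [simp]: "arr (nev x)" "dom (nev x) = x @ du x" "cod (nev x) = []"
  by (simp_all add: nev_def)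

text \<open>A strand that crosses both legs of the cap in the same way slides off it: naturality of
  the braiding, which is trivial against the empty list.\<close>

lemma nev_slide:
  "(nev x \<odot> ident y) \<star> (ident x \<odot> br y (du x)) \<star> (br y x \<odot> ident (du x)) = ident y \<odot> nev x"
  using br_natural[of "ident y" "nev x" y y "x @ du x" "[]"] by (simp add: br_append_right)

section \<open>Independence of the trace from the chosen dual\<close>

definition is_dual :: "'o list \<Rightarrow> 'o list \<Rightarrow> 'a \<Rightarrow> 'a \<Rightarrow> bool" where
  "is_dual x y e k \<longleftrightarrow> arr e \<and> dom e = y @ x \<and> cod e = [] \<and> arr k \<and> dom k = [] \<and> cod k = x @ y \<and>
     (ident x \<odot> e) \<star> (k \<odot> ident x) = ident x"

definition tr :: "'o list \<Rightarrow> 'a \<Rightarrow> 'a" where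
  "tr x f = nev x \<star> ((tw x \<star> f) \<odot> ident (du x)) \<star> cvl x"

text \<open>The canonical map \<phi> from \<open>y\<close> to \<open>du x\<close> carries one
  duality to the other: the zigzag of \<open>du x\<close> turns \<open>evl x\<close> into
  \<open>e\<close>, and the zigzag of \<open>y\<close> turns \<open>k\<close> into
  \<open>cvl x\<close>. Naturality of the braiding moves \<phi> around the loop from the cap to the
  cup.\<close>

lemma tr_is_dual:
  assumes "is_dual x y e k" and f [simp]: "arr f" "dom f = x" "cod f = x"
  shows "e \<star> br x y \<star> ((tw x \<star> f) \<odot> ident y) \<star> k = tr x f"
proof -
  have [simp]: "arr e" "dom e = y @ x" "cod e = []" "arr k" "dom k = []" "cod k = x @ y"
    and zz: "(ident x \<odot> e) \<star> (k \<odot> ident x) = ident x"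
    using assms(1) by (auto simp: is_dual_def)
  define \<phi> where "\<phi> = (e \<odot> ident (du x)) \<star> (ident y \<odot> cvl x)"
  have [simp]: "arr \<phi>" "dom \<phi> = y" "cod \<phi> = du x" by (simp_all add: \<phi>_def)
  have s1: "(ident (y @ x) \<odot> evl x) \<star> (ident y \<odot> cvl x \<odot> ident x) = ident (y @ x)"
    using arg_cong[OF zigzag[of x], of "\<lambda>u. ident y \<odot> u"] by (simp add: normalize)
  have "evl x \<star> (\<phi> \<odot> ident x) = (evl x \<star> (e \<odot> ident (du x @ x))) \<star> (ident y \<odot> cvl x \<odot> ident x)"
    by (simp add: \<phi>_def normalize)
  also have "evl x \<star> (e \<odot> ident (du x @ x)) = e \<star> (ident (y @ x) \<odot> evl x)"
    using slide[of e "evl x" "y @ x" "[]" "du x @ x" "[]"] by simp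
  finally have ev: "evl x \<star> (\<phi> \<odot> ident x) = e"
    by (simp add: comp_assoc s1)
  have s2: "(ident x \<odot> e \<odot> ident (du x)) \<star> (k \<odot> ident (x @ du x)) = ident (x @ du x)"
    using arg_cong[OF zz, of "\<lambda>u. u \<odot> ident (du x)"] by (simp add: normalize)
  have "(ident x \<odot> \<phi>) \<star> k = (ident x \<odot> e \<odot> ident (du x)) \<star> ((ident (x @ y) \<odot> cvl x) \<star> k)"
    by (simp add: \<phi>_def normalize)
  also have "(ident (x @ y) \<odot> cvl x) \<star> k = (k \<odot> ident (x @ du x)) \<star> cvl x"
    using slide[of k "cvl x" "[]" "x @ y" "[]" "x @ du x"] by simp
  finally have coev: "(ident x \<odot> \<phi>) \<star> k = cvl x"
    by (simp add: comp_tail[OF s2])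
  let ?g = "tw x \<star> f"
  have "e \<star> br x y \<star> (?g \<odot> ident y) \<star> k = evl x \<star> ((\<phi> \<odot> ident x) \<star> br x y) \<star> (?g \<odot> ident y) \<star> k"
    by (simp add: ev[symmetric] comp_assoc)
  also have "(\<phi> \<odot> ident x) \<star> br x y = br x (du x) \<star> (ident x \<odot> \<phi>)"
    by (rule br_natural[symmetric]) simp_all
  also have "evl x \<star> (br x (du x) \<star> (ident x \<odot> \<phi>)) \<star> (?g \<odot> ident y) \<star> k
      = nev x \<star> ((ident x \<odot> \<phi>) \<star> (?g \<odot> ident y)) \<star> k"
    by (simp add: nev_def comp_assoc)
  also have "(ident x \<odot> \<phi>) \<star> (?g \<odot> ident y) = (?g \<odot> ident (du x)) \<star> (ident x \<odot> \<phi>)"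
    by (rule slide[symmetric]) simp_all
  finally show ?thesis
    by (simp add: tr_def comp_assoc coev)
qed

section \<open>Partial traces\<close>

text \<open>The two ends \<open>x\<close> and \<open>x'\<close> of the open part are kept apart
  because the braidings to be closed permute the factors; they are identified only when the lists
  commute.\<close>

definition ptr :: "'o list \<Rightarrow> 'o list \<Rightarrow> 'o list \<Rightarrow> 'a \<Rightarrow> 'a" where
  "ptr x x' y h = (ident x' \<odot> nev y) \<star> (ident x' \<odot> tw y \<odot> ident (du y)) \<star> (h \<odot> ident (du y)) \<star>
     (ident x \<odot> cvl y)"

lemma ptr_simps [simp]:
  assumes "arr h" "dom h = x @ y" "cod h = x' @ y"
  shows "arr (ptr x x' y h)" "dom (ptr x x' y h) = x" "cod (ptr x x' y h) = x'"
  using assms by (simp_all add: ptr_def)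

abbreviation tensor_ev :: "'o list \<Rightarrow> 'o list \<Rightarrow> 'a" where
  "tensor_ev x y \<equiv> evl y \<star> (ident (du y) \<odot> evl x \<odot> ident y)"

abbreviation tensor_coev :: "'o list \<Rightarrow> 'o list \<Rightarrow> 'a" where
  "tensor_coev x y \<equiv> (ident x \<odot> cvl y \<odot> ident (du x)) \<star> cvl x"

text \<open>Nested cups and caps. The height exchange \<open>s1\<close> separates them, and then
  each pair straightens by its own zigzag.\<close>

lemma is_dual_append: "is_dual (x @ y) (du y @ du x) (tensor_ev x y) (tensor_coev x y)"
proof -
  have s1: "(ident (x @ y @ du y) \<odot> evl x \<odot> ident y) \<star> (ident x \<odot> cvl y \<odot> ident (du x @ x @ y))
     = (ident x \<odot> cvl y \<odot> ident y) \<star> (ident x \<odot> evl x \<odot> ident y)"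
    using arg_cong[OF slide[of "cvl y" "evl x" "[]" "y @ du y" "du x @ x" "[]"],
        of "\<lambda>u. ident x \<odot> u \<odot> ident y"] by (simp add: normalize)
  have s2: "(ident x \<odot> evl x \<odot> ident y) \<star> (cvl x \<odot> ident (x @ y)) = ident (x @ y)"
    using arg_cong[OF zigzag[of x], of "\<lambda>u. u \<odot> ident y"] by (simp add: normalize)
  have s3: "(ident (x @ y) \<odot> evl y) \<star> (ident x \<odot> cvl y \<odot> ident y) = ident (x @ y)"
    using arg_cong[OF zigzag[of y], of "\<lambda>u. ident x \<odot> u"] by (simp add: normalize)
  have "(ident (x @ y) \<odot> tensor_ev x y) \<star> (tensor_coev x y \<odot> ident (x @ y)) = ident (x @ y)"
    by (simp add: normalize comp_tail[OF s1] s2 s3)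
  then show ?thesis by (simp add: is_dual_def)
qed

text \<open>Braiding \<open>x @ y\<close> past \<open>du y @ du x\<close> makes \<open>x\<close> and
  \<open>y\<close> cross each other's duals as well. Each of the two braidings of \<open>x\<close>
  with \<open>y\<close> is consumed by one use of \<open>nev_slide\<close>, which frees one strand
  from the cap of the other; only nested caps remain.\<close>

lemma tensor_nev:
  "tensor_ev x y \<star> br (x @ y) (du y @ du x) \<star> (br y x \<odot> ident (du y @ du x)) \<star> (br x y \<odot> ident (du y @ du x))
   = nev x \<star> (ident x \<odot> nev y \<odot> ident (du x))"
proof -
  let ?dx = "du x" and ?dy = "du y"
  have "(evl x \<odot> ident y) \<star> br (x @ y) ?dx = (nev x \<odot> ident y) \<star> (ident x \<odot> br y ?dx)"
    by (simp add: br_append_left nev_def normalize)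
  from arg_cong[OF this, of "\<lambda>u. ident ?dy \<odot> u"]
  have a: "(ident ?dy \<odot> evl x \<odot> ident y) \<star> (ident ?dy \<odot> br (x @ y) ?dx)
      = (ident ?dy \<odot> nev x \<odot> ident y) \<star> (ident (?dy @ x) \<odot> br y ?dx)"
    by (simp add: normalize)
  have n: "(ident ?dy \<odot> nev x \<odot> ident y) \<star> (ident (?dy @ x) \<odot> br y ?dx) \<star>
      (ident ?dy \<odot> br y x \<odot> ident ?dx) = ident (?dy @ y) \<odot> nev x"
    using arg_cong[OF nev_slide[of x y], of "\<lambda>u. ident ?dy \<odot> u"] by (simp add: normalize)
  have "br (x @ y) ?dy \<star> (br y x \<odot> ident ?dy) = (ident ?dy \<odot> br y x) \<star> br (y @ x) ?dy"
    by (rule br_natural) simp_all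
  from arg_cong[OF this, of "\<lambda>u. u \<odot> ident ?dx"]
  have b: "(br (x @ y) ?dy \<odot> ident ?dx) \<star> (br y x \<odot> ident (?dy @ ?dx))
      = (ident ?dy \<odot> br y x \<odot> ident ?dx) \<star> (br (y @ x) ?dy \<odot> ident ?dx)"
    by (simp add: normalize)
  have d: "(nev y \<odot> ident (x @ ?dx)) \<star> (ident y \<odot> br x ?dy \<odot> ident ?dx) \<star> (br x y \<odot> ident (?dy @ ?dx))
      = ident x \<odot> nev y \<odot> ident ?dx"
    using arg_cong[OF nev_slide[of y x], of "\<lambda>u. u \<odot> ident ?dx"] by (simp add: normalize)
  have e: "evl y \<star> (ident (?dy @ y) \<odot> nev x) = nev x \<star> (evl y \<odot> ident (x @ ?dx))"
    using slide[of "evl y" "nev x" "?dy @ y" "[]" "x @ ?dx" "[]"] by simp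
  have "tensor_ev x y \<star> br (x @ y) (?dy @ ?dx) \<star> (br y x \<odot> ident (?dy @ ?dx)) \<star> (br x y \<odot> ident (?dy @ ?dx))
    = evl y \<star> (ident ?dy \<odot> nev x \<odot> ident y) \<star> (ident (?dy @ x) \<odot> br y ?dx) \<star>
      (br (x @ y) ?dy \<odot> ident ?dx) \<star> (br y x \<odot> ident (?dy @ ?dx)) \<star> (br x y \<odot> ident (?dy @ ?dx))"
    by (simp only: br_append_right comp_assoc comp_tail[OF a])
  also have "\<dots> = evl y \<star> ((ident ?dy \<odot> nev x \<odot> ident y) \<star> (ident (?dy @ x) \<odot> br y ?dx) \<star>
      (ident ?dy \<odot> br y x \<odot> ident ?dx)) \<star> (br (y @ x) ?dy \<odot> ident ?dx) \<star> (br x y \<odot> ident (?dy @ ?dx))"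
    by (simp only: comp_assoc comp_tail[OF b])
  also have "\<dots> = nev x \<star> (evl y \<odot> ident (x @ ?dx)) \<star> (br (y @ x) ?dy \<odot> ident ?dx) \<star>
      (br x y \<odot> ident (?dy @ ?dx))"
    unfolding n by (simp only: comp_assoc comp_tail[OF e])
  also have "\<dots> = nev x \<star> (nev y \<odot> ident (x @ ?dx)) \<star> (ident y \<odot> br x ?dy \<odot> ident ?dx) \<star>
      (br x y \<odot> ident (?dy @ ?dx))"
    by (simp add: br_append_left[of y x] nev_def[of y] normalize)
  finally show ?thesis by (simp only: d)
qed

lemma tw_append': "tw (x @ y) = br y x \<star> br x y \<star> (tw x \<odot> tw y)"
proof -
  have "(tw x \<odot> tw y) \<star> br y x = br y x \<star> (tw y \<odot> tw x)" for x y
    by (rule br_natural[symmetric]) simp_all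
  from this comp_tail[OF this] show ?thesis
    by (simp add: tw_append comp_assoc)
qed

text \<open>By \<open>tr_is_dual\<close> the nested duality may be used. The double braiding
  contained in \<open>tw (x @ y)\<close> is exactly what \<open>tensor_nev\<close> absorbs.\<close>

lemma tr_append:
  assumes [simp]: "arr h" "dom h = x @ y" "cod h = x @ y"
  shows "tr (x @ y) h = tr x (ptr x x y h)"
proof -
  let ?i = "ident (du y @ du x)" and ?dx = "du x" and ?dy = "du y"
  have s: "(ident x \<odot> nev y \<odot> ident ?dx) \<star> (tw x \<odot> tw y \<odot> ?i)
    = (tw x \<odot> ident ?dx) \<star> (ident x \<odot> nev y \<odot> ident ?dx) \<star> (ident x \<odot> tw y \<odot> ?i)"
  proof -
    let ?r = "tw y \<odot> ident ?dy"
    have "tw x \<odot> ?r = (tw x \<odot> ident (y @ ?dy)) \<star> (ident x \<odot> ?r)"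
      by (subst interchange) simp_all
    moreover have "(ident x \<odot> nev y) \<star> (tw x \<odot> ident (y @ ?dy)) = tw x \<star> (ident x \<odot> nev y)"
      using slide[of "tw x" "nev y" x x "y @ ?dy" "[]"] by simp
    ultimately have "(ident x \<odot> nev y) \<star> (tw x \<odot> ?r) = tw x \<star> (ident x \<odot> nev y) \<star> (ident x \<odot> ?r)"
      by (metis comp_assoc)
    from arg_cong[OF this, of "\<lambda>u. u \<odot> ident ?dx"] show ?thesis
      by (simp add: normalize)
  qed
  have "tr (x @ y) h = tensor_ev x y \<star> br (x @ y) (?dy @ ?dx) \<star> ((tw (x @ y) \<star> h) \<odot> ?i) \<star> tensor_coev x y"
    by (rule tr_is_dual[OF is_dual_append, symmetric]) simp_all
  also have "\<dots> = (tensor_ev x y \<star> br (x @ y) (?dy @ ?dx) \<star> (br y x \<odot> ?i) \<star> (br x y \<odot> ?i)) \<star>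
      (tw x \<odot> tw y \<odot> ?i) \<star> (h \<odot> ?i) \<star> tensor_coev x y"
    by (simp add: tw_append' normalize)
  also have "\<dots> = nev x \<star> ((ident x \<odot> nev y \<odot> ident ?dx) \<star> (tw x \<odot> tw y \<odot> ?i)) \<star> (h \<odot> ?i) \<star> tensor_coev x y"
    unfolding tensor_nev by (simp only: comp_assoc)
  also have "\<dots> = tr x (ptr x x y h)"
    unfolding s by (simp add: tr_def ptr_def normalize)
  finally show ?thesis .
qed

lemma ptr_post:
  assumes [simp]: "arr h" "dom h = x @ y" "cod h = x' @ y" "arr u" "dom u = x'" "cod u = x''"
  shows "ptr x x'' y ((u \<odot> ident y) \<star> h) = u \<star> ptr x x' y h"
proof -
  have "(ident x'' \<odot> nev y) \<star> (ident x'' \<odot> tw y \<odot> ident (du y)) \<star> (u \<odot> ident (y @ du y))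
      = u \<star> (ident x' \<odot> nev y) \<star> (ident x' \<odot> tw y \<odot> ident (du y))"
  proof -
    have "(u \<odot> ident []) \<star> (ident x' \<odot> (nev y \<star> (tw y \<odot> ident (du y))))
        = (ident x'' \<odot> (nev y \<star> (tw y \<odot> ident (du y)))) \<star> (u \<odot> ident (y @ du y))"
      by (rule slide) simp_all
    then show ?thesis by (simp add: normalize)
  qed
  from comp_tail[OF this] show ?thesis
    by (simp add: ptr_def normalize)
qed

lemma ptr_pre:
  assumes [simp]: "arr h" "dom h = x @ y" "cod h = x' @ y" "arr u" "dom u = x''" "cod u = x"
  shows "ptr x'' x' y (h \<star> (u \<odot> ident y)) = ptr x x' y h \<star> u"
  using slide[of u "cvl y" x'' x "[]" "y @ du y"]
  by (simp add: ptr_def normalize)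

lemma ptr_ident: "ptr x x y (ident (x @ y)) = ident x \<odot> tr y (ident y)"
  by (simp add: ptr_def tr_def normalize)

lemma ptr_whisker:
  assumes [simp]: "arr h" "dom h = x @ y" "cod h = x' @ y"
  shows "ptr (z @ x) (z @ x') y (ident z \<odot> h) = ident z \<odot> ptr x x' y h"
  by (simp add: ptr_def normalize)

text \<open>The curl. Without its twist the loop straightens: the two braidings combine into one of
  \<open>y\<close> past \<open>y @ du y\<close>, which slides off the cup and leaves a zigzag. The
  twist of the closed strand passes through the crossing onto the open strand and is all that
  survives.\<close>

lemma ptr_br_self: "ptr y y y (br y y) = tw y"
proof -
  let ?d = "du y"
  have "ptr y y y (br y y) = (ident y \<odot> nev y) \<star> (ident y \<odot> tw y \<odot> ident ?d) \<star>
      (br y y \<odot> ident ?d) \<star> (ident y \<odot> cvl y)"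
    by (simp add: ptr_def)
  have t: "(ident y \<odot> tw y \<odot> ident ?d) \<star> (br y y \<odot> ident ?d) = (br y y \<odot> ident ?d) \<star> (tw y \<odot> ident (y @ ?d))"
    using arg_cong[OF br_natural[of "tw y" "ident y" y y y y], of "\<lambda>u. u \<odot> ident ?d"]
    by (simp add: normalize)
  have "(ident y \<odot> br y ?d) \<star> (br y y \<odot> ident ?d) \<star> (ident y \<odot> cvl y) = cvl y \<odot> ident y"
    using br_natural[of "ident y" "cvl y" y y "[]" "y @ ?d"] by (simp add: br_append_right comp_assoc)
  then have k: "(ident y \<odot> nev y) \<star> (br y y \<odot> ident ?d) \<star> (ident y \<odot> cvl y) = ident y"
    by (simp add: nev_def normalize zigzag)
  have "ptr y y y (br y y) = (ident y \<odot> nev y) \<star> ((ident y \<odot> tw y \<odot> ident ?d) \<star>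
      (br y y \<odot> ident ?d)) \<star> (ident y \<odot> cvl y)"
    by (simp add: ptr_def comp_assoc)
  also have "\<dots> = (ident y \<odot> nev y) \<star> (br y y \<odot> ident ?d) \<star> ((tw y \<odot> ident (y @ ?d)) \<star> (ident y \<odot> cvl y))"
    unfolding t by (simp only: comp_assoc)
  also have "(tw y \<odot> ident (y @ ?d)) \<star> (ident y \<odot> cvl y) = (ident y \<odot> cvl y) \<star> tw y"
    using slide[of "tw y" "cvl y" y y "[]" "y @ ?d"] by simp
  also have "(ident y \<odot> nev y) \<star> (br y y \<odot> ident ?d) \<star> (ident y \<odot> cvl y) \<star> tw y
      = ((ident y \<odot> nev y) \<star> (br y y \<odot> ident ?d) \<star> (ident y \<odot> cvl y)) \<star> tw y"
    by (simp only: comp_assoc)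
  finally show ?thesis by (simp add: k)
qed

lemma scalar_slide:
  assumes [simp]: "arr s" "dom s = []" "cod s = []" "arr f"
  shows "f \<star> (s \<odot> ident (dom f)) = s \<odot> f" "(s \<odot> ident (cod f)) \<star> f = s \<odot> f"
  using interchange[of s "ident []" "ident (dom f)" f] interchange[of "ident []" s f "ident (cod f)"]
  by simp_all

lemma scalar_comm:
  assumes [simp]: "arr s" "dom s = []" "cod s = []"
  shows "ident x \<odot> s = s \<odot> ident x"
  using br_natural[of "ident x" s x x "[]" "[]"] by simp

lemma tr_simps [simp]:
  assumes "arr f" "dom f = x" "cod f = x"
  shows "arr (tr x f)" "dom (tr x f) = []" "cod (tr x f) = []"
  using assms by (simp_all add: tr_def)

lemma tr_scalar:
  assumes [simp]: "arr s" "dom s = []" "cod s = []" "arr f" "dom f = x" "cod f = x"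
  shows "tr x (s \<odot> f) = s \<star> tr x f"
proof -
  have "tr x (s \<odot> f) = tr x ((s \<odot> ident x) \<star> f)"
    using scalar_slide(2)[of s f] by simp
  also have "\<dots> = (nev x \<star> (tw x \<odot> ident (du x)) \<star> (s \<odot> ident (x @ du x))) \<star> (f \<odot> ident (du x)) \<star> cvl x"
    by (simp add: tr_def normalize)
  also have "nev x \<star> (tw x \<odot> ident (du x)) \<star> (s \<odot> ident (x @ du x)) = s \<star> nev x \<star> (tw x \<odot> ident (du x))"
    using scalar_slide[of s "nev x \<star> (tw x \<odot> ident (du x))"] by (simp add: comp_assoc)
  finally show ?thesis
    by (simp add: tr_def normalize)
qed

lemma tr_ident_append: "tr (x @ y) (ident (x @ y)) = tr y (ident y) \<star> tr x (ident x)"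
  by (simp add: tr_append ptr_ident scalar_comm tr_scalar)

text \<open>Starting at exponent one avoids computing the trace of the identity of the unit.\<close>

lemma tr_ident_lpow: "tr (lpow w (Suc k)) (ident (lpow w (Suc k))) = arr_pow (tr w (ident w)) (Suc k)"
proof (induction k)
  case (Suc k)
  have "tr (lpow w (Suc (Suc k))) (ident (lpow w (Suc (Suc k)))) =
    tr w (ident w) \<star> tr (lpow w (Suc k)) (ident (lpow w (Suc k)))"
    unfolding lpow_Suc2[of w "Suc k"] by (rule tr_ident_append)
  then show ?case using Suc by simp
qed simp

section \<open>Closing the strands of a braid one at a time\<close>

text \<open>After passing \<open>y\<close>, the strand \<open>x\<close> crosses the last
  \<open>x\<close>. Closing the latter turns this crossing into a curl, that is, a twist, which
  slides back to the start of the strand.\<close>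

lemma ptr_br_append_right:
  assumes [simp]: "arr f" "dom f = x" "cod f = x"
  shows "ptr (x @ y) (y @ x) x (br x (y @ x) \<star> (f \<odot> ident (y @ x))) = br x y \<star> ((tw x \<star> f) \<odot> ident y)"
proof -
  let ?h = "br x y \<star> (f \<odot> ident y)"
  have "ptr (x @ y) (y @ x) x (br x (y @ x) \<star> (f \<odot> ident (y @ x))) =
      ptr (x @ y) (y @ x) x ((ident y \<odot> br x x) \<star> (?h \<odot> ident x))"
    unfolding br_append_right by (simp add: normalize)
  also have "\<dots> = ptr (y @ x) (y @ x) x (ident y \<odot> br x x) \<star> ?h"
    by (rule ptr_pre) simp_all
  also have "\<dots> = ((ident y \<odot> tw x) \<star> br x y) \<star> (f \<odot> ident y)"
    by (simp only: ptr_whisker[of "br x x" x x x y] arr_br dom_br cod_br ptr_br_self comp_assoc)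
  also have "(ident y \<odot> tw x) \<star> br x y = br x y \<star> (tw x \<odot> ident y)"
    by (rule br_natural[symmetric]) simp_all
  finally show ?thesis
    by (simp add: normalize)
qed

lemma tr_peel:
  assumes xy: "x @ y = y @ x" and f: "arr f" "dom f = x" "cod f = x"
  shows "tr (x @ y @ x) (br x (y @ x) \<star> (f \<odot> ident (y @ x))) = tr (x @ y) (br x y \<star> ((tw x \<star> f) \<odot> ident y))"
proof -
  let ?h = "br x (y @ x) \<star> (f \<odot> ident (y @ x))"
  have "tr ((x @ y) @ x) ?h = tr (x @ y) (ptr (x @ y) (x @ y) x ?h)"
  proof (rule tr_append)
    show "cod ?h = (x @ y) @ x" unfolding xy using f by simp
  qed (use f in simp_all)
  then show ?thesis
    using ptr_br_append_right[OF f, of y] by (simp only: xy[symmetric] append_assoc)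
qed

text \<open>The arbitrary \<open>f\<close> on the moving block collects one twist for each copy of
  \<open>x\<close> that is closed. All blocks are powers of \<open>w\<close>, so the lists commute
  as \<open>tr_peel\<close> requires.\<close>

lemma tr_peel_lpow:
  fixes w :: "'o list" and k :: nat
  defines "x \<equiv> lpow w k"
  assumes f: "arr f" "dom f = x" "cod f = x"
  shows "tr (x @ w @ lpow x j) (br x (w @ lpow x j) \<star> (f \<odot> ident (w @ lpow x j)))
    = tr (x @ w) (br x w \<star> ((arr_pow (tw x) j \<star> f) \<odot> ident w))"
  using f
proof (induction j arbitrary: f)
  case 0
  then show ?case by simp
next
  case (Suc j)
  let ?y = "w @ lpow x j"
  have y: "w @ lpow x (Suc j) = ?y @ x" "x @ ?y = ?y @ x"
    unfolding x_def by (metis append_assoc lpow_Suc2 lpow_append_commute lpow.simps(2))+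
  have "tr (x @ ?y @ x) (br x (?y @ x) \<star> (f \<odot> ident (?y @ x))) = tr (x @ ?y) (br x ?y \<star> ((tw x \<star> f) \<odot> ident ?y))"
    by (rule tr_peel) (use Suc.prems y in auto)
  also have "\<dots> = tr (x @ w) (br x w \<star> ((arr_pow (tw x) j \<star> tw x \<star> f) \<odot> ident w))"
    by (rule Suc.IH) (use Suc.prems in auto)
  also have "arr_pow (tw x) j \<star> tw x \<star> f = arr_pow (tw x) (Suc j) \<star> f"
    by (simp only: arr_pow_Suc2 arr_tw dom_tw cod_tw comp_assoc)
  finally show ?case by (simp only: y)
qed

text \<open>Here the moving block \<open>z @ w\<close> passes a single \<open>w\<close>. The closed
  strand meets only the last factor of the block in a self-crossing, so the curl sits on that
  factor.\<close>

lemma ptr_br_append_left: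
  assumes [simp]: "arr f" "dom f = z @ w" "cod f = z @ w"
  shows "ptr (z @ w) (w @ z) w (br (z @ w) w \<star> (f \<odot> ident w)) = br z w \<star> (ident z \<odot> tw w) \<star> f"
proof -
  have "ptr (z @ w) (w @ z) w (br (z @ w) w \<star> (f \<odot> ident w)) =
      ptr (z @ w) (w @ z) w ((br z w \<odot> ident w) \<star> (ident z \<odot> br w w) \<star> (f \<odot> ident w))"
    unfolding br_append_left by (simp add: normalize)
  also have "\<dots> = br z w \<star> ptr (z @ w) (z @ w) w ((ident z \<odot> br w w) \<star> (f \<odot> ident w))"
    by (rule ptr_post) simp_all
  also have "ptr (z @ w) (z @ w) w ((ident z \<odot> br w w) \<star> (f \<odot> ident w)) = ptr (z @ w) (z @ w) w (ident z \<odot> br w w) \<star> f"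
    by (rule ptr_pre) simp_all
  finally show ?thesis
    by (simp only: ptr_whisker[of "br w w" w w w z] arr_br dom_br cod_br ptr_br_self)
qed

lemma tr_peel_last:
  assumes zw: "z @ w = w @ z" and f: "arr f" "dom f = z @ w" "cod f = z @ w"
  shows "tr ((z @ w) @ w) (br (z @ w) w \<star> (f \<odot> ident w)) = tr (z @ w) (br z w \<star> (ident z \<odot> tw w) \<star> f)"
proof -
  let ?h = "br (z @ w) w \<star> (f \<odot> ident w)"
  have "tr ((z @ w) @ w) ?h = tr (z @ w) (ptr (z @ w) (z @ w) w ?h)"
  proof (rule tr_append)
    show "cod ?h = (z @ w) @ w" using f by (simp add: zw)
  qed (use f in simp_all)
  then show ?thesis
    using ptr_br_append_left[OF f] by (simp only: zw[symmetric])
qed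

text \<open>One strand moved past \<open>k\<close> others closes to an unknot: closing the last
  strand removes one crossing and leaves a twist, \<open>k\<close> times over. The exponent
  \<open>i\<close> carries the twists already collected through the induction.\<close>

lemma tr_br_lpow:
  "tr (lpow w (Suc k)) (br (lpow w k) w \<star> (ident (lpow w k) \<odot> arr_pow (tw w) i)) = tr w (arr_pow (tw w) (i + k))"
proof (induction k arbitrary: i)
  case 0
  then show ?case by simp
next
  case (Suc k)
  let ?z = "lpow w k" and ?u = "arr_pow (tw w)"
  have zw: "?z @ w = w @ ?z" by (rule lpow_append_commute)
  \<comment> \<open>The collected twists sit on the strand about to be closed; through the crossing
    they move to a strand that stays open, where \<open>ptr_post\<close> can extract them.\<close>
  have n: "(ident ?z \<odot> br w w) \<star> (ident (?z @ w) \<odot> ?u i) = (ident ?z \<odot> ?u i \<odot> ident w) \<star> (ident ?z \<odot> br w w)"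
    using arg_cong[OF br_natural[of "ident w" "?u i" w w w w], of "\<lambda>v. ident ?z \<odot> v"]
    by (simp add: normalize)
  have "br (?z @ w) w \<star> (ident (?z @ w) \<odot> ?u i)
    = ((br ?z w \<star> (ident ?z \<odot> ?u i)) \<odot> ident w) \<star> (ident ?z \<odot> br w w)"
    unfolding br_append_left comp_assoc n by (simp add: normalize)
  then have "ptr (?z @ w) (w @ ?z) w (br (?z @ w) w \<star> (ident (?z @ w) \<odot> ?u i))
    = (br ?z w \<star> (ident ?z \<odot> ?u i)) \<star> ptr (?z @ w) (?z @ w) w (ident ?z \<odot> br w w)"
    by (simp only:) (rule ptr_post, simp_all)
  also have "\<dots> = br ?z w \<star> (ident ?z \<odot> (?u i \<star> tw w))"
    by (simp only: ptr_whisker[of "br w w" w w w ?z] arr_br dom_br cod_br ptr_br_self) (simp add: normalize)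
  also have "?u i \<star> tw w = ?u (Suc i)"
    by (simp only: arr_pow_Suc2 arr_tw dom_tw cod_tw)
  finally have p: "ptr (?z @ w) (?z @ w) w (br (?z @ w) w \<star> (ident (?z @ w) \<odot> ?u i))
      = br ?z w \<star> (ident ?z \<odot> ?u (Suc i))"
    by (simp only: zw)
  have "tr ((?z @ w) @ w) (br (?z @ w) w \<star> (ident (?z @ w) \<odot> ?u i))
     = tr (?z @ w) (br ?z w \<star> (ident ?z \<odot> ?u (Suc i)))"
    unfolding p[symmetric] by (rule tr_append) (simp_all add: zw)
  then show ?case
    using Suc.IH[of "Suc i"] by (simp only: lpow_Suc2 add_Suc add_Suc_right)
qed

section \<open>Rotations of tensor powers\<close>

definition rot :: "'o list \<Rightarrow> 'o list \<Rightarrow> 'a" where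
  "rot x y = br x y \<star> (tw x \<odot> ident y)"

lemma rot_simps [simp]: "arr (rot x y)" "dom (rot x y) = x @ y" "cod (rot x y) = y @ x"
  by (simp_all add: rot_def)

text \<open>Rotating \<open>x\<close> and then \<open>y\<close> takes each past the other. This
  double braiding and the two separate twists make up \<open>tw (x @ y)\<close>, which is why
  \<open>rot\<close> contains a twist.\<close>

lemma rot_comp: "rot y (z @ x) \<star> rot x (y @ z) = rot (x @ y) z"
proof -
  have b1: "(tw y \<odot> ident (z @ x)) \<star> (ident y \<odot> br x z) = (ident y \<odot> br x z) \<star> (tw y \<odot> ident (x @ z))"
    by (rule slide) simp_all
  have b2: "(tw y \<odot> ident (x @ z)) \<star> (br x y \<odot> ident z) = (br x y \<odot> ident z) \<star> (ident x \<odot> tw y \<odot> ident z)"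
    using arg_cong[OF br_natural[of "ident x" "tw y" x x y y], of "\<lambda>u. u \<odot> ident z"]
    by (simp add: normalize)
  have b3: "tw x \<odot> tw y \<odot> ident z = (ident x \<odot> tw y \<odot> ident z) \<star> (tw x \<odot> ident (y @ z))"
    by (subst interchange) simp_all
  have b4: "br (x @ y) z \<star> (br y x \<odot> ident z) = (ident z \<odot> br y x) \<star> br (y @ x) z"
    by (rule br_natural) simp_all
  have "rot y (z @ x) \<star> rot x (y @ z) = (ident z \<odot> br y x) \<star> (br y z \<odot> ident x) \<star> (ident y \<odot> br x z) \<star>
      (br x y \<odot> ident z) \<star> (ident x \<odot> tw y \<odot> ident z) \<star> (tw x \<odot> ident (y @ z))"
    by (simp only: rot_def br_append_right comp_assoc comp_tail[OF b1] comp_tail[OF b2])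
  also have "\<dots> = (ident z \<odot> br y x) \<star> br (y @ x) z \<star> (br x y \<odot> ident z) \<star> (tw x \<odot> tw y \<odot> ident z)"
    by (simp only: b3 br_append_left comp_assoc)
  also have "\<dots> = br (x @ y) z \<star> (br y x \<odot> ident z) \<star> (br x y \<odot> ident z) \<star> (tw x \<odot> tw y \<odot> ident z)"
    by (simp only: comp_tail[OF b4] comp_assoc)
  also have "\<dots> = rot (x @ y) z"
    by (simp add: rot_def tw_append' normalize)
  finally show ?thesis .
qed

lemma rot_Nil: "rot x [] = tw x"
  by (simp add: rot_def)

lemma rot_pow: "arr_pow (rot w (lpow w (i + j))) (Suc i) = rot (lpow w (Suc i)) (lpow w j)"
proof (induction i arbitrary: j)
  case 0
  then show ?case by simp
next
  case (Suc i)
  \<comment> \<open>The inductive power ends with the moved factors behind the others; this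
    rewriting shows the next rotation in the form demanded by \<open>rot_comp\<close>.\<close>
  have "rot w (lpow w (Suc i + j)) = rot w (lpow w j @ lpow w (Suc i))"
    by (metis lpow_add add.commute)
  moreover have "arr_pow (rot w (lpow w (Suc i + j))) (Suc i) = rot (lpow w (Suc i)) (w @ lpow w j)"
    using Suc.IH[of "Suc j"] by simp
  ultimately have "arr_pow (rot w (lpow w (Suc i + j))) (Suc (Suc i)) = rot (lpow w (Suc i) @ w) (lpow w j)"
    by (simp only: arr_pow.simps(2)[of _ "Suc i"] rot_comp)
  then show ?case by (simp only: lpow_Suc2)
qed

text \<open>After a full turn nothing is left to be passed, and only the twist of the whole power
  remains.\<close>

lemma rot_pow_eq_tw: "arr_pow (rot w (lpow w n)) (Suc n) = tw (lpow w (Suc n))"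
  using rot_pow[of w n 0] by (simp add: rot_Nil)

text \<open>The comparison of the two torus knots, with \<open>Suc k\<close> for l. The tensor power
  is read as \<open>x @ w @ lpow x j\<close>; the rotation by \<open>Suc k\<close> factors moves the
  first \<open>x\<close> past the rest. Closing \<open>j\<close> blocks, and then the single
  \<open>w\<close>, leaves an endomorphism of \<open>x\<close>. Of the \<open>Suc j\<close> twists
  on \<open>x\<close>, one comes from \<open>rot\<close> and \<open>j\<close> from curls.\<close>

lemma tr_rot_pow:
  fixes w :: "'o list" and k :: nat
  defines "x \<equiv> lpow w (Suc k)"
  assumes n: "n = k + Suc (Suc k * j)"
  shows "tr (lpow w (Suc n)) (arr_pow (rot w (lpow w n)) (Suc k)) =
    tr x ((br (lpow w k) w \<star> (ident (lpow w k) \<odot> tw w)) \<star> arr_pow (tw x) (Suc j))"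
proof -
  let ?y = "w @ lpow x j" and ?z = "lpow w k"
  have x: "x = ?z @ w" unfolding x_def by (rule lpow_Suc2)
  have y: "lpow w (Suc (Suc k * j)) = ?y" unfolding x_def by (simp only: lpow.simps(2) lpow_mult)
  have "Suc n = Suc k + Suc (Suc k * j)" using n by simp
  then have 1: "lpow w (Suc n) = x @ ?y" by (metis lpow_add x_def y)
  have "arr_pow (rot w (lpow w n)) (Suc k) = rot x ?y"
    unfolding n using rot_pow[of w k "Suc (Suc k * j)"] y by (simp only: x_def)
  then have "tr (lpow w (Suc n)) (arr_pow (rot w (lpow w n)) (Suc k)) =
      tr (x @ w @ lpow x j) (br x ?y \<star> (tw x \<odot> ident ?y))"
    by (simp only: 1 rot_def)
  also have "\<dots> = tr (x @ w) (br x w \<star> ((arr_pow (tw x) j \<star> tw x) \<odot> ident w))"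
    unfolding x_def by (rule tr_peel_lpow) simp_all
  also have "arr_pow (tw x) j \<star> tw x = arr_pow (tw x) (Suc j)"
    by (simp only: arr_pow_Suc2 arr_tw dom_tw cod_tw)
  also have "tr (x @ w) (br x w \<star> (arr_pow (tw x) (Suc j) \<odot> ident w))
      = tr (?z @ w) (br ?z w \<star> (ident ?z \<odot> tw w) \<star> arr_pow (tw x) (Suc j))"
    unfolding x by (rule tr_peel_last) (simp_all add: lpow_append_commute)
  finally show ?thesis
    by (simp only: comp_assoc flip: x)
qed

end


section \<open>Strictification\<close>

text \<open>Ill-typed composites and tensor products are \<open>Null\<close>, which makes both operations associative
  without typing conditions.\<close>

datatype ('o, 'f) hom_arrow = Null | Arrow (source: 'o) (label: 'f) (target: 'o)

text \<open>Hom sets may overlap, so arrows carry their endpoints. The construction is used twice: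
  for the given category, and for its strictification, whose labels are arrows of the first
  kind.\<close>

locale hom_category =
  fixes H :: "'o \<Rightarrow> 'o \<Rightarrow> 'f set" and cmp :: "'f \<Rightarrow> 'f \<Rightarrow> 'f" and one :: "'o \<Rightarrow> 'f"
  assumes one_in_H: "one x \<in> H x x"
    and cmp_in_H: "\<lbrakk>f \<in> H x y; g \<in> H y z\<rbrakk> \<Longrightarrow> cmp g f \<in> H x z"
    and cmp_one_left: "f \<in> H x y \<Longrightarrow> cmp (one y) f = f"
    and cmp_one_right: "f \<in> H x y \<Longrightarrow> cmp f (one x) = f"
    and cmp_assoc: "\<lbrakk>f \<in> H x y; g \<in> H y z; h \<in> H z w\<rbrakk> \<Longrightarrow> cmp (cmp h g) f = cmp h (cmp g f)"
begin

definition harr :: "('o, 'f) hom_arrow \<Rightarrow> bool" where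
  "harr u \<longleftrightarrow> (\<exists>x f y. u = Arrow x f y \<and> f \<in> H x y)"

definition hcomp :: "('o, 'f) hom_arrow \<Rightarrow> ('o, 'f) hom_arrow \<Rightarrow> ('o, 'f) hom_arrow" where
  "hcomp u v = (if harr u \<and> harr v \<and> source u = target v
     then Arrow (source v) (cmp (label u) (label v)) (target u) else Null)"

definition hident :: "'o \<Rightarrow> ('o, 'f) hom_arrow" where
  "hident x = Arrow x (one x) x"

lemma harr_Arrow [simp]: "harr (Arrow x f y) \<longleftrightarrow> f \<in> H x y"
  by (auto simp: harr_def)

lemma harr_Null [simp]: "\<not> harr Null"
  by (auto simp: harr_def)

lemma harrE:
  assumes "harr u"
  obtains x f y where "u = Arrow x f y" "f \<in> H x y"
  using assms by (auto simp: harr_def)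

lemma harr_hcomp [simp]: "harr (hcomp u v) \<longleftrightarrow> harr v \<and> harr u \<and> source u = target v"
  by (auto simp: hcomp_def intro: cmp_in_H elim!: harrE)

lemma hom_arrow_eqI:
  "\<lbrakk>harr u; harr v; source u = source v; target u = target v; label u = label v\<rbrakk> \<Longrightarrow> u = v"
  by (auto elim!: harrE)

lemma hcomp_simps [simp]:
  assumes "harr u" "harr v" "source u = target v"
  shows "source (hcomp u v) = source v" "target (hcomp u v) = target u"
    "label (hcomp u v) = cmp (label u) (label v)"
  using assms by (simp_all add: hcomp_def)

lemma hcomp_Null: "\<not> harr (hcomp u v) \<Longrightarrow> hcomp u v = Null"
  by (metis hcomp_def harr_hcomp)

lemma hcomp_assoc: "hcomp (hcomp w v) u = hcomp w (hcomp v u)"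
proof (cases "harr (hcomp (hcomp w v) u)")
  case True
  then have "harr u" "harr v" "harr w" "target u = source v" "target v = source w"
    by auto
  then show ?thesis
    by (intro hom_arrow_eqI) (auto simp: cmp_assoc elim!: harrE)
next
  case False
  moreover from this have "\<not> harr (hcomp w (hcomp v u))" by auto
  ultimately show ?thesis by (simp add: hcomp_Null del: harr_hcomp)
qed

sublocale arrow_category harr source target hcomp hident
  by unfold_locales
    (auto simp: hcomp_assoc hident_def one_in_H cmp_one_left cmp_one_right intro!: hom_arrow_eqI elim!: harrE)

lemma inverse_arrows_Arrow:
  "inverse_arrows (Arrow x f y) (Arrow y g x) \<longleftrightarrow>
     f \<in> H x y \<and> g \<in> H y x \<and> cmp g f = one x \<and> cmp f g = one y"
  by (auto simp: inverse_arrows_def hcomp_def hident_def)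

end


locale ribbon_arrows = monoidal_arrows arr dom cod comp ident tobj tens unit ass lun run
  for arr :: "'a \<Rightarrow> bool" and dom cod :: "'a \<Rightarrow> 'o"
    and comp :: "'a \<Rightarrow> 'a \<Rightarrow> 'a"  (infixr "\<star>" 65)
    and ident :: "'o \<Rightarrow> 'a"
    and tobj :: "'o \<Rightarrow> 'o \<Rightarrow> 'o"  (infixr "\<boxtimes>" 75)
    and tens :: "'a \<Rightarrow> 'a \<Rightarrow> 'a"  (infixr "\<odot>" 75)
    and unit :: 'o
    and ass :: "'o \<Rightarrow> 'o \<Rightarrow> 'o \<Rightarrow> 'a" and lun run :: "'o \<Rightarrow> 'a" +
  fixes br :: "'o \<Rightarrow> 'o \<Rightarrow> 'a"
    and tw :: "'o \<Rightarrow> 'a"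
    and du :: "'o \<Rightarrow> 'o"
    and evl cvl :: "'o \<Rightarrow> 'a"
  assumes invertible_br [simp]: "invertible (br x y)"
    and dom_br [simp]: "dom (br x y) = x \<boxtimes> y"
    and cod_br [simp]: "cod (br x y) = y \<boxtimes> x"
    and br_natural: "\<lbrakk>arr f; arr g; x = dom f; x' = cod f; y = dom g; y' = cod g\<rbrakk> \<Longrightarrow>
      br x' y' \<star> (f \<odot> g) = (g \<odot> f) \<star> br x y"
    and hexagon1: "ass y z x \<star> br x (y \<boxtimes> z) \<star> ass x y z =
      (ident y \<odot> br x z) \<star> ass y x z \<star> (br x y \<odot> ident z)"
    and hexagon2: "br (x \<boxtimes> y) z =
      ass z x y \<star> (br x z \<odot> ident y) \<star> inv_arr (ass x z y) \<star> (ident x \<odot> br y z) \<star> ass x y z"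
    and arr_tw [simp]: "arr (tw x)"
    and dom_tw [simp]: "dom (tw x) = x"
    and cod_tw [simp]: "cod (tw x) = x"
    and tw_natural: "\<lbrakk>arr f; x = dom f; y = cod f\<rbrakk> \<Longrightarrow> tw y \<star> f = f \<star> tw x"
    and tw_tens: "tw (x \<boxtimes> y) = (tw x \<odot> tw y) \<star> br y x \<star> br x y"
    and arr_evl [simp]: "arr (evl x)"
    and dom_evl [simp]: "dom (evl x) = du x \<boxtimes> x"
    and cod_evl [simp]: "cod (evl x) = unit"
    and arr_cvl [simp]: "arr (cvl x)"
    and dom_cvl [simp]: "dom (cvl x) = unit"
    and cod_cvl [simp]: "cod (cvl x) = x \<boxtimes> du x"
    and zigzag: "run x \<star> (ident x \<odot> evl x) \<star> ass x (du x) x \<star> (cvl x \<odot> ident x) = lun x"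
begin

lemma arr_br [simp]: "arr (br x y)"
  by (simp add: arr_if_invertible)

section \<open>The strict tensor product on lists\<close>

text \<open>This makes \<open>lobj\<close> fully faithful by construction; composition is inherited
  and only the tensor product has to be transported along \<open>mult\<close>.\<close>

definition shom :: "'o list \<Rightarrow> 'o list \<Rightarrow> 'a set" where
  "shom x y = {f. arr f \<and> dom f = lobj x \<and> cod f = lobj y}"

sublocale S: hom_category shom comp "\<lambda>x. ident (lobj x)"
  by unfold_locales (auto simp: shom_def comp_assoc)

lemma label_simps [simp]:
  assumes "S.harr u"
  shows "arr (label u)" "dom (label u) = lobj (source u)" "cod (label u) = lobj (target u)"
  using assms by (auto simp: shom_def elim!: S.harrE)

definition stens :: "('o list, 'a) hom_arrow \<Rightarrow> ('o list, 'a) hom_arrow \<Rightarrow> ('o list, 'a) hom_arrow" where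
  "stens u v = (if S.harr u \<and> S.harr v then
     Arrow (source u @ source v)
       (mult (target u) (target v) \<star> (label u \<odot> label v) \<star> inv_arr (mult (source u) (source v)))
       (target u @ target v)
     else Null)"

lemma harr_stens [simp]: "S.harr (stens u v) \<longleftrightarrow> S.harr u \<and> S.harr v"
  by (auto simp: stens_def shom_def)

lemma stens_simps [simp]:
  assumes "S.harr u" "S.harr v"
  shows "source (stens u v) = source u @ source v" "target (stens u v) = target u @ target v"
  using assms by (simp_all add: stens_def)

text \<open>The transported structure maps are only ever used through such intertwining relations with
  \<^const>\<open>mult\<close>, so that no inverses occur in the calculations.\<close>

lemma label_stens:
  assumes "S.harr u" "S.harr v" "x = source u" "y = source v"
  shows "label (stens u v) \<star> mult x y = mult (target u) (target v) \<star> (label u \<odot> label v)"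
  using assms by (simp add: stens_def comp_assoc)

text \<open>Here \<open>k\<close> is taken to be a composite of \<open>mult\<close> isomorphisms,
  which brings both sides into the form to which the intertwining relations apply.\<close>

lemma strict_eqI:
  assumes "S.harr u" "S.harr v" "source u = source v" "target u = target v"
    and "invertible k" "cod k = lobj (source u)" "label u \<star> k = label v \<star> k"
  shows "u = v"
proof (rule S.hom_arrow_eqI)
  show "label u = label v"
    by (rule invertible_cancel_right[OF assms(5)]) (use assms in simp_all)
qed (use assms in simp_all)

text \<open>Seen from the fully left-bracketed product, the two sides differ by an associator at
  each end; \<open>mult_coherence\<close> produces these and naturality cancels them.\<close>

lemma stens_assoc: "stens (stens u v) w = stens u (stens v w)"
proof (cases "S.harr u \<and> S.harr v \<and> S.harr w")
  case True
  then have [simp]: "S.harr u" "S.harr v" "S.harr w" by auto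
  let ?k = "mult (source u @ source v) (source w) \<star> (mult (source u) (source v) \<odot> ident (lobj (source w)))"
  show ?thesis
  proof (rule strict_eqI)
    show "invertible ?k" by (intro invertible_comp invertible_tens) simp_all
    let ?M = "mult (target u) (target v @ target w)"
    let ?f = "label u" and ?g = "label v" and ?h = "label w"
    have "label (stens (stens u v) w) \<star> ?k = mult (target u @ target v) (target w) \<star>
       ((label (stens u v) \<star> mult (source u) (source v)) \<odot> ?h)"
      by (simp add: comp_tail[OF label_stens] interchange comp_assoc)
    also have "\<dots> = (mult (target u @ target v) (target w) \<star>
        (mult (target u) (target v) \<odot> ident (lobj (target w)))) \<star> ((?f \<odot> ?g) \<odot> ?h)"
      by (simp add: label_stens interchange comp_assoc)
    also have "\<dots> = ?M \<star> (ident (lobj (target u)) \<odot> mult (target v) (target w)) \<star>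
        ass (lobj (target u)) (lobj (target v)) (lobj (target w)) \<star> ((?f \<odot> ?g) \<odot> ?h)"
      unfolding mult_coherence by (simp only: comp_assoc)
    also have "\<dots> = ?M \<star> (?f \<odot> (mult (target v) (target w) \<star> (?g \<odot> ?h))) \<star>
        ass (lobj (source u)) (lobj (source v)) (lobj (source w))"
      using ass_natural[of ?f ?g ?h] by (simp add: interchange_tail)
    also have "\<dots> = label (stens u (stens v w)) \<star> ?k"
      unfolding mult_coherence
      by (simp add: comp_tail[OF label_stens] label_stens[symmetric] interchange interchange_tail comp_assoc)
    finally show "label (stens (stens u v) w) \<star> ?k = label (stens u (stens v w)) \<star> ?k" .
  qed simp_all
qed (auto simp: stens_def)

sublocale S: strict_monoidal_arrows S.harr source target S.hcomp S.hident stens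
proof
  show "S.hcomp (stens f' g') (stens f g) = stens (S.hcomp f' f) (S.hcomp g' g)"
    if [simp]: "S.harr f" "S.harr f'" "S.harr g" "S.harr g'" "source f' = target f" "source g' = target g"
    for f f' g g'
    by (rule strict_eqI[of _ _ "mult (source f) (source g)"])
      (simp_all add: label_stens comp_tail[OF label_stens] interchange interchange_tail comp_assoc)
  show "stens (S.hident x) (S.hident y) = S.hident (x @ y)" for x y
    by (rule strict_eqI[of _ _ "mult x y"])
      (simp_all add: label_stens S.hident_def shom_def)
  show "stens (S.hident []) f = f" if [simp]: "S.harr f" for f
  proof (rule strict_eqI[of _ _ "mult [] (source f)"])
    show "label (stens (S.hident []) f) \<star> mult [] (source f) = label f \<star> mult [] (source f)"
      using label_stens[of "S.hident []" f "[]" "source f"] lun_natural[of "label f"]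
      by (simp add: S.hident_def shom_def)
  qed simp_all
  show "stens f (S.hident []) = f" if [simp]: "S.harr f" for f
  proof (rule strict_eqI[of _ _ "mult (source f) []"])
    show "label (stens f (S.hident [])) \<star> mult (source f) [] = label f \<star> mult (source f) []"
      using label_stens[of f "S.hident []" "source f" "[]"] run_natural[of "label f"]
      by (simp add: S.hident_def shom_def mult_Nil_right)
  qed simp_all
qed (simp_all add: stens_assoc)

section \<open>Transported braiding, twist and duals\<close>

definition sbr :: "'o list \<Rightarrow> 'o list \<Rightarrow> ('o list, 'a) hom_arrow" where
  "sbr x y = Arrow (x @ y) (mult y x \<star> br (lobj x) (lobj y) \<star> inv_arr (mult x y)) (y @ x)"

definition stw :: "'o list \<Rightarrow> ('o list, 'a) hom_arrow" where
  "stw x = Arrow x (tw (lobj x)) x"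

text \<open>A one-letter list, so the strict trace is the given trace formula at
  \<open>lobj x\<close>. The price is that \<open>sdu (x @ y)\<close> differs from
  \<open>sdu y @ sdu x\<close>, a gap bridged by \<open>tr_is_dual\<close>.\<close>

definition sdu :: "'o list \<Rightarrow> 'o list" where
  "sdu x = [du (lobj x)]"

definition sevl :: "'o list \<Rightarrow> ('o list, 'a) hom_arrow" where
  "sevl x = Arrow (sdu x @ x) (evl (lobj x) \<star> inv_arr (mult (sdu x) x)) []"

definition scvl :: "'o list \<Rightarrow> ('o list, 'a) hom_arrow" where
  "scvl x = Arrow [] (mult x (sdu x) \<star> cvl (lobj x)) (x @ sdu x)"

lemma lobj_sdu [simp]: "lobj (sdu x) = du (lobj x)"
  by (simp add: sdu_def)

lemma structure_simps [simp]:
  "S.harr (sbr x y)" "source (sbr x y) = x @ y" "target (sbr x y) = y @ x"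
  "S.harr (stw x)" "source (stw x) = x" "target (stw x) = x" "label (stw x) = tw (lobj x)"
  "S.harr (sevl x)" "source (sevl x) = sdu x @ x" "target (sevl x) = []"
  "S.harr (scvl x)" "source (scvl x) = []" "target (scvl x) = x @ sdu x"
  "label (S.hident x) = ident (lobj x)"
  by (simp_all add: sbr_def stw_def sevl_def scvl_def shom_def S.hident_def)

lemma label_sbr: "label (sbr x y) \<star> mult x y = mult y x \<star> br (lobj x) (lobj y)"
  by (simp add: sbr_def comp_assoc)

lemma label_sevl: "label (sevl x) \<star> mult (sdu x) x = evl (lobj x)"
  by (simp add: sevl_def comp_assoc)

lemma label_scvl: "label (scvl x) = mult x (sdu x) \<star> cvl (lobj x)"
  by (simp add: scvl_def)

lemma invertible_sbr: "S.invertible (sbr x y)"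
proof -
  have "invertible (inv_arr (mult x y))"
    by (simp add: invertible_inv_arr)
  then have i: "invertible (label (sbr x y))"
    by (auto simp: sbr_def intro!: invertible_comp)
  have "S.inverse_arrows (sbr x y) (Arrow (y @ x) (inv_arr (label (sbr x y))) (x @ y))"
    using i unfolding sbr_def S.inverse_arrows_Arrow
    by (simp add: shom_def)
  then show ?thesis by (auto simp: S.invertible_def)
qed

text \<open>Naturality of the braiding moves \<open>mult y z\<close> across it. What remains between
  the coherence isomorphisms is \<open>hexagon1\<close>, whose associators
  \<open>mult_coherence\<close> absorbs.\<close>

lemma sbr_append_right:
  "sbr x (y @ z) = S.hcomp (stens (S.hident y) (sbr x z)) (stens (sbr x y) (S.hident z))"
proof -
  let ?X = "lobj x" and ?Y = "lobj y" and ?Z = "lobj z"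
  let ?k = "mult (x @ y) z \<star> (mult x y \<odot> ident ?Z)"
  let ?l1 = "label (stens (S.hident y) (sbr x z))" and ?l2 = "label (stens (sbr x y) (S.hident z))"
  have n: "br ?X (lobj (y @ z)) \<star> (ident ?X \<odot> mult y z) = (mult y z \<odot> ident ?X) \<star> br ?X (?Y \<boxtimes> ?Z)"
    by (rule br_natural) simp_all
  have "label (sbr x (y @ z)) \<star> ?k = label (sbr x (y @ z)) \<star> mult x (y @ z) \<star> (ident ?X \<odot> mult y z) \<star> ass ?X ?Y ?Z"
    by (simp only: mult_coherence)
  also have "\<dots> = mult (y @ z) x \<star> (mult y z \<odot> ident ?X) \<star> br ?X (?Y \<boxtimes> ?Z) \<star> ass ?X ?Y ?Z"
    by (simp only: comp_tail[OF label_sbr] comp_tail[OF n] comp_assoc)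
  also have "\<dots> = mult y (z @ x) \<star> (ident ?Y \<odot> mult z x) \<star> ass ?Y ?Z ?X \<star> br ?X (?Y \<boxtimes> ?Z) \<star> ass ?X ?Y ?Z"
    by (simp only: comp_tail[OF mult_coherence] comp_assoc)
  also have "\<dots> = mult y (z @ x) \<star> (ident ?Y \<odot> mult z x) \<star>
      (ident ?Y \<odot> br ?X ?Z) \<star> ass ?Y ?X ?Z \<star> (br ?X ?Y \<odot> ident ?Z)"
    by (simp only: hexagon1)
  also have "\<dots> = (?l1 \<star> mult y (x @ z)) \<star> (ident ?Y \<odot> mult x z) \<star> ass ?Y ?X ?Z \<star> (br ?X ?Y \<odot> ident ?Z)"
    by (simp add: label_stens label_sbr interchange_tail comp_assoc)
  also have "\<dots> = ?l1 \<star> mult (y @ x) z \<star> (mult y x \<odot> ident ?Z) \<star> (br ?X ?Y \<odot> ident ?Z)"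
    by (simp only: comp_tail[OF mult_coherence] comp_assoc)
  also have "\<dots> = ?l1 \<star> ?l2 \<star> ?k"
    by (simp add: comp_tail[OF label_stens] label_sbr interchange comp_assoc)
  finally have "label (sbr x (y @ z)) \<star> ?k = (?l1 \<star> ?l2) \<star> ?k"
    by (simp only: comp_assoc)
  then show ?thesis
    by (intro strict_eqI[of _ _ ?k]) (simp_all add: invertible_comp invertible_tens)
qed

lemma sbr_append_left:
  "sbr (x @ y) z = S.hcomp (stens (sbr x z) (S.hident y)) (stens (S.hident x) (sbr y z))"
proof -
  let ?X = "lobj x" and ?Y = "lobj y" and ?Z = "lobj z"
  let ?k = "mult (x @ y) z \<star> (mult x y \<odot> ident ?Z)"
  let ?l1 = "label (stens (sbr x z) (S.hident y))" and ?l2 = "label (stens (S.hident x) (sbr y z))"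
  let ?r = "(ident ?X \<odot> br ?Y ?Z) \<star> ass ?X ?Y ?Z"
  have n: "br (lobj (x @ y)) ?Z \<star> (mult x y \<odot> ident ?Z) = (ident ?Z \<odot> mult x y) \<star> br (?X \<boxtimes> ?Y) ?Z"
    by (rule br_natural) simp_all
  \<comment> \<open>\<open>mult_coherence\<close> solved for the side without associator, to absorb
    the inverse associator of \<open>hexagon2\<close>.\<close>
  have m: "mult x (z @ y) \<star> (ident ?X \<odot> mult z y) =
      mult (x @ z) y \<star> (mult x z \<odot> ident ?Y) \<star> inv_arr (ass ?X ?Z ?Y)"
    using arg_cong[OF mult_coherence[of x z y], of "\<lambda>u. u \<star> inv_arr (ass ?X ?Z ?Y)"]
    by (simp add: comp_assoc)
  have "label (sbr (x @ y) z) \<star> ?k = mult z (x @ y) \<star> (ident ?Z \<odot> mult x y) \<star> br (?X \<boxtimes> ?Y) ?Z"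
    by (simp only: comp_tail[OF label_sbr] n comp_assoc)
  also have "\<dots> = mult (z @ x) y \<star> (mult z x \<odot> ident ?Y) \<star> (br ?X ?Z \<odot> ident ?Y) \<star> inv_arr (ass ?X ?Z ?Y) \<star> ?r"
    by (simp only: hexagon2 comp_tail[OF mult_coherence] comp_assoc)
  also have "\<dots> = ?l1 \<star> (mult (x @ z) y \<star> (mult x z \<odot> ident ?Y) \<star> inv_arr (ass ?X ?Z ?Y)) \<star> ?r"
    by (simp add: comp_tail[OF label_stens] label_sbr interchange_tail interchange comp_assoc)
  also have "\<dots> = ?l1 \<star> mult x (z @ y) \<star> (ident ?X \<odot> mult z y) \<star> ?r"
    by (simp only: m[symmetric] comp_assoc)
  also have "\<dots> = ?l1 \<star> ?l2 \<star> mult x (y @ z) \<star> (ident ?X \<odot> mult y z) \<star> ass ?X ?Y ?Z"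
    by (simp add: comp_tail[OF label_stens] label_sbr interchange_tail comp_assoc)
  also have "\<dots> = (?l1 \<star> ?l2) \<star> ?k"
    by (simp only: mult_coherence comp_assoc)
  finally show ?thesis
    by (intro strict_eqI[of _ _ ?k]) (simp_all add: invertible_comp invertible_tens)
qed

text \<open>The unit constraints in the given zigzag are \<open>mult x []\<close> and
  \<open>mult [] x\<close>, so they disappear in the strictification.\<close>

lemma strict_zigzag:
  "S.hcomp (stens (S.hident x) (sevl x)) (stens (scvl x) (S.hident x)) = S.hident x"
proof -
  let ?X = "lobj x" and ?d = "sdu x"
  let ?l = "label (stens (S.hident x) (sevl x))"
  have "?l \<star> label (stens (scvl x) (S.hident x)) \<star> mult [] x
    = (?l \<star> mult (x @ ?d) x \<star> (mult x ?d \<odot> ident ?X)) \<star> (cvl ?X \<odot> ident ?X)"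
    by (simp add: label_stens label_scvl interchange comp_assoc del: mult.simps)
  also have "\<dots> = (?l \<star> mult x (?d @ x)) \<star> (ident ?X \<odot> mult ?d x) \<star> ass ?X (du ?X) ?X \<star> (cvl ?X \<odot> ident ?X)"
    by (simp only: mult_coherence comp_assoc lobj_sdu)
  also have "\<dots> = run ?X \<star> (ident ?X \<odot> evl ?X) \<star> ass ?X (du ?X) ?X \<star> (cvl ?X \<odot> ident ?X)"
    by (simp add: label_stens label_sevl mult_Nil_right interchange_tail comp_assoc)
  also have "\<dots> = mult [] x"
    by (simp add: zigzag)
  finally show ?thesis
    by (intro strict_eqI[of _ _ "mult [] x"]) (simp_all add: comp_assoc)
qed

sublocale S: strict_ribbon_arrows S.harr source target S.hcomp S.hident stens sbr stw sdu sevl scvl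
proof
  show "S.hcomp (sbr x' y') (stens f g) = S.hcomp (stens g f) (sbr x y)"
    if "S.harr f" "S.harr g" and [simp]: "x = source f" "x' = target f" "y = source g" "y' = target g"
    for f g x x' y y'
    using that(1,2)
    by (intro strict_eqI[of _ _ "mult x y"])
      (simp_all add: label_stens label_sbr comp_tail[OF label_stens] comp_tail[OF label_sbr] comp_assoc
        br_natural[of "label f" "label g"])
  show "S.hcomp (stw y) f = S.hcomp f (stw x)" if "S.harr f" "x = source f" "y = target f" for f x y
    using that by (intro S.hom_arrow_eqI) (simp_all add: tw_natural)
  show "stw (x @ y) = S.hcomp (stens (stw x) (stw y)) (S.hcomp (sbr y x) (sbr x y))" for x y
  proof (rule strict_eqI[of _ _ "mult x y"])
    have "tw (lobj (x @ y)) \<star> mult x y = mult x y \<star> tw (lobj x \<boxtimes> lobj y)"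
      by (rule tw_natural) simp_all
    then show "label (stw (x @ y)) \<star> mult x y =
        label (S.hcomp (stens (stw x) (stw y)) (S.hcomp (sbr y x) (sbr x y))) \<star> mult x y"
      by (simp add: label_sbr comp_tail[OF label_sbr] comp_tail[OF label_stens] comp_assoc tw_tens)
  qed simp_all
qed (simp_all add: invertible_sbr sbr_append_right sbr_append_left strict_zigzag)

lemma label_tr:
  assumes [simp]: "S.harr u" "source u = x" "target u = x"
  shows "label (S.tr x u) = evl (lobj x) \<star> br (lobj x) (du (lobj x)) \<star>
    ((tw (lobj x) \<star> label u) \<odot> ident (du (lobj x))) \<star> cvl (lobj x)"
  by (simp add: S.tr_def S.nev_def label_scvl label_sbr label_sevl comp_tail[OF label_stens]
      comp_tail[OF label_sbr] comp_tail[OF label_sevl] comp_assoc)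

end


section \<open>Nilpotent and unipotent endomorphisms\<close>

context linear_category
begin

sublocale V: vector_space "scale C"
  by (rule vector_space_scale)

sublocale A: hom_category "Hom C" "comp_mor C" "idm C"
  by unfold_locales (auto simp: id_in_Hom comp_in_Hom comp_id_left comp_id_right comp_assoc)

lemma zero_in_Hom [simp]: "0 \<in> Hom C X Y"
  using subspace_Hom V.subspace_0 by blast

lemma add_in_Hom: "\<lbrakk>f \<in> Hom C X Y; g \<in> Hom C X Y\<rbrakk> \<Longrightarrow> f + g \<in> Hom C X Y"
  using subspace_Hom V.subspace_add by blast

lemma diff_in_Hom: "\<lbrakk>f \<in> Hom C X Y; g \<in> Hom C X Y\<rbrakk> \<Longrightarrow> f - g \<in> Hom C X Y"
  using subspace_Hom V.subspace_diff by blast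

lemma scale_in_Hom: "f \<in> Hom C X Y \<Longrightarrow> scale C k f \<in> Hom C X Y"
  using subspace_Hom V.subspace_scale by blast

lemmas Hom_intros = id_in_Hom comp_in_Hom add_in_Hom diff_in_Hom scale_in_Hom zero_in_Hom

lemma comp_zero_right: "f \<in> Hom C Y Z \<Longrightarrow> f \<cdot> 0 = 0"
  using comp_scale_right[of 0 _ Y f Z 0] by simp

lemma comp_zero_left: "f \<in> Hom C X Y \<Longrightarrow> 0 \<cdot> f = 0"
  using comp_scale_left[of f X Y 0 _ 0] by simp

lemma comp_diff_right:
  assumes "f \<in> Hom C X Y" "f' \<in> Hom C X Y" "g \<in> Hom C Y Z"
  shows "g \<cdot> (f - f') = (g \<cdot> f) - (g \<cdot> f')"
  using comp_add_right[of "f - f'" X Y f' g Z] assms by (simp add: diff_in_Hom eq_diff_eq)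

lemma mor_pow_in_Hom: "f \<in> Hom C X X \<Longrightarrow> mor_pow C X f n \<in> Hom C X X"
  by (induction n) (auto intro: Hom_intros)

section \<open>Polynomials in an endomorphism\<close>

text \<open>Horner evaluation at \<open>f\<close>. It reduces statements about unipotent powers to
  divisibility of polynomials over the ground field.\<close>

definition peval :: "'o \<Rightarrow> 'm \<Rightarrow> 'k poly \<Rightarrow> 'm" where
  "peval X f P = foldr (\<lambda>a r. scale C a (idm C X) + (f \<cdot> r)) (coeffs P) 0"

lemma peval_0 [simp]: "peval X f 0 = 0"
  by (simp add: peval_def)

context
  fixes X f
  assumes f: "f \<in> Hom C X X"
begin

lemma peval_pCons: "peval X f (pCons a P) = scale C a (idm C X) + (f \<cdot> peval X f P)"
  using comp_zero_right[OF f] by (simp add: peval_def cCons_def)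

lemma peval_in_Hom [simp]: "peval X f P \<in> Hom C X X"
  by (induction P) (auto simp: peval_pCons f intro!: Hom_intros)

lemma peval_add: "peval X f (P + Q) = peval X f P + peval X f Q"
proof (induction P Q rule: poly_induct2)
  case (pCons a P b Q)
  then show ?case
    by (simp add: peval_pCons V.scale_left_distrib comp_add_right[OF peval_in_Hom peval_in_Hom f] add_ac)
qed simp

lemma peval_smult: "peval X f (smult a P) = scale C a (peval X f P)"
proof (induction P)
  case (pCons b P)
  then show ?case
    by (simp add: peval_pCons V.scale_right_distrib comp_scale_right[OF peval_in_Hom f])
qed simp

lemma peval_mult: "peval X f (P * Q) = peval X f P \<cdot> peval X f Q"
proof (induction P)
  case 0
  then show ?case by (simp add: comp_zero_left[OF peval_in_Hom])
next
  case (pCons a P)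
  have "peval X f (pCons a P * Q) = scale C a (peval X f Q) + (f \<cdot> (peval X f P \<cdot> peval X f Q))"
    by (simp add: peval_add peval_smult peval_pCons pCons.IH)
  also have "f \<cdot> (peval X f P \<cdot> peval X f Q) = (f \<cdot> peval X f P) \<cdot> peval X f Q"
    by (rule comp_assoc[OF peval_in_Hom peval_in_Hom f, symmetric])
  also have "scale C a (peval X f Q) = scale C a (idm C X) \<cdot> peval X f Q"
    by (simp add: comp_scale_left[OF peval_in_Hom id_in_Hom] comp_id_left[OF peval_in_Hom])
  also have "\<dots> + ((f \<cdot> peval X f P) \<cdot> peval X f Q) = peval X f (pCons a P) \<cdot> peval X f Q"
    unfolding peval_pCons
    by (rule comp_add_left[OF peval_in_Hom scale_in_Hom[OF id_in_Hom] comp_in_Hom[OF peval_in_Hom f], symmetric])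
  finally show ?case .
qed

lemma peval_1 [simp]: "peval X f 1 = idm C X"
  by (simp add: peval_pCons one_pCons comp_zero_right[OF f])

lemma peval_power: "peval X f (P ^ n) = mor_pow C X (peval X f P) n"
  by (induction n) (simp_all add: peval_mult)

lemma peval_diff: "peval X f (P - Q) = peval X f P - peval X f Q"
  using peval_add[of "P - Q" Q] by simp

lemma peval_X [simp]: "peval X f [:0, 1:] = f"
  by (simp add: peval_pCons comp_zero_right[OF f] comp_id_right[OF f])

lemma peval_X_power_minus_1: "peval X f ([:0, 1:] ^ n - 1) = mor_pow C X f n - idm C X"
  by (simp only: peval_diff peval_power peval_X peval_1)

text \<open>If the \<open>N\<close>-th power of \<open>P\<close> vanishes at \<open>f\<close>, so
  does its multiple \<open>Q ^ (k * N)\<close>.\<close>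

lemma nilpotent_peval_dvd:
  assumes "nilpotent C X (peval X f P)" "P dvd Q ^ k"
  shows "nilpotent C X (peval X f Q)"
proof -
  obtain N where N: "mor_pow C X (peval X f P) N = 0"
    using assms(1) by (auto simp: nilpotent_def)
  obtain R where R: "Q ^ (k * N) = R * P ^ N"
    using dvd_power_same[OF assms(2), of N] by (metis dvdE mult.commute power_mult)
  have "mor_pow C X (peval X f Q) (k * N) = peval X f R \<cdot> mor_pow C X (peval X f P) N"
    by (simp only: peval_power[symmetric] R peval_mult)
  then show ?thesis
    unfolding nilpotent_def N using comp_zero_right[OF peval_in_Hom] peval_in_Hom by metis
qed

text \<open>x^s - 1 divides x^(sj) - 1.\<close>

lemma unipotent_mor_pow_mult:
  assumes "unipotent C X (mor_pow C X f s)"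
  shows "unipotent C X (mor_pow C X f (s * j))"
proof -
  have "([:0, 1:] ^ s - 1 :: 'k poly) dvd ([:0, 1:] ^ (s * j) - 1) ^ 1"
    using power_diff_1_eq[of "[:0, 1:] ^ s :: 'k poly" j] by (simp add: power_mult)
  then show ?thesis
    using nilpotent_peval_dvd assms
    unfolding unipotent_def peval_X_power_minus_1[symmetric] by blast
qed

lemma unipotent_if_mor_pow_char_power:
  assumes "prime CHAR('k)" "unipotent C X (mor_pow C X f (CHAR('k) ^ n))"
  shows "unipotent C X f"
proof -
  let ?x = "[:0, 1:] :: 'k poly" and ?m = "CHAR('k) ^ n"
  \<comment> \<open>Adding 1 back, rather than expanding the power of a difference, avoids the sign
    (-1)^m and with it a case distinction for characteristic 2.\<close>
  have "(?x - 1) ^ ?m + 1 ^ ?m = (?x - 1 + 1) ^ ?m"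
    by (rule freshmans_dream'[symmetric]) (use assms in auto)
  \<comment> \<open>The exponent 1 is kept so that both polynomials have the shape of
    \<open>peval_X_power_minus_1\<close>.\<close>
  then have "?x ^ ?m - 1 = (?x ^ 1 - 1) ^ ?m"
    by (simp add: algebra_simps)
  then have "?x ^ ?m - 1 dvd (?x ^ 1 - 1) ^ ?m"
    by (simp only: dvd_refl)
  moreover have "mor_pow C X f 1 = f"
    using f by (simp add: comp_id_right)
  ultimately show ?thesis
    using nilpotent_peval_dvd assms(2)
    unfolding unipotent_def peval_X_power_minus_1[symmetric] by (metis peval_X_power_minus_1)
qed

end

section \<open>Commuting endomorphisms\<close>

lemma mor_pow_commute:
  assumes "f \<in> Hom C X X" "g \<in> Hom C X X" "f \<cdot> g = g \<cdot> f"
  shows "mor_pow C X f k \<cdot> g = g \<cdot> mor_pow C X f k"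
proof (induction k)
  case 0
  then show ?case using assms by (simp add: comp_id_left comp_id_right)
next
  case (Suc k)
  have "mor_pow C X f (Suc k) \<cdot> g = f \<cdot> (mor_pow C X f k \<cdot> g)"
    using comp_assoc[OF assms(2) mor_pow_in_Hom[OF assms(1)] assms(1)] by simp
  also have "\<dots> = (f \<cdot> g) \<cdot> mor_pow C X f k"
    using comp_assoc[OF mor_pow_in_Hom[OF assms(1)] assms(2,1)] Suc by simp
  also have "\<dots> = g \<cdot> mor_pow C X f (Suc k)"
    using comp_assoc[OF mor_pow_in_Hom[OF assms(1)] assms(1,2)] assms(3) by simp
  finally show ?case .
qed

lemma mor_pow_comp:
  assumes "f \<in> Hom C X X" "g \<in> Hom C X X" "f \<cdot> g = g \<cdot> f"
  shows "mor_pow C X (f \<cdot> g) k = mor_pow C X f k \<cdot> mor_pow C X g k"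
proof (induction k)
  case 0
  then show ?case by (simp add: comp_id_left[OF id_in_Hom])
next
  case (Suc k)
  note [intro] = assms(1,2) mor_pow_in_Hom comp_in_Hom
  let ?F = "mor_pow C X f k" and ?G = "mor_pow C X g k"
  have F: "?F \<in> Hom C X X" and G: "?G \<in> Hom C X X" by auto
  have "mor_pow C X (f \<cdot> g) (Suc k) = f \<cdot> ((g \<cdot> ?F) \<cdot> ?G)"
    using Suc comp_assoc[OF comp_in_Hom[OF G F] assms(2,1)] comp_assoc[OF G F assms(2)] by simp
  also have "g \<cdot> ?F = ?F \<cdot> g"
    using mor_pow_commute[OF assms] by simp
  also have "f \<cdot> ((?F \<cdot> g) \<cdot> ?G) = (f \<cdot> ?F) \<cdot> (g \<cdot> ?G)"
    using comp_assoc[OF G assms(2) F] comp_assoc[OF comp_in_Hom[OF G assms(2)] F assms(1)] by simp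
  finally show ?case by simp
qed

text \<open>The difference is f (u - 1), a product of commuting endomorphisms with one factor
  nilpotent. This is how a unipotent factor is dropped under a trace.\<close>

lemma nilpotent_comp_unipotent_diff:
  assumes f: "f \<in> Hom C X X" and u: "u \<in> Hom C X X" and fu: "f \<cdot> u = u \<cdot> f"
    and uni: "unipotent C X u"
  shows "nilpotent C X ((f \<cdot> u) - f)"
proof -
  let ?d = "u - idm C X"
  have d: "?d \<in> Hom C X X" using u by (intro diff_in_Hom id_in_Hom)
  have fd: "f \<cdot> ?d = (f \<cdot> u) - f"
    using comp_diff_right[OF u id_in_Hom f] comp_id_right[OF f] by simp
  have "(?d + idm C X) \<cdot> f = (?d \<cdot> f) + (idm C X \<cdot> f)"
    by (rule comp_add_left[OF f d id_in_Hom])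
  then have "f \<cdot> ?d = ?d \<cdot> f"
    using fd fu comp_id_left[OF f] by simp
  moreover obtain N where "mor_pow C X ?d N = 0"
    using uni by (auto simp: unipotent_def nilpotent_def)
  ultimately have "mor_pow C X (f \<cdot> ?d) N = 0"
    using mor_pow_comp[OF f d] comp_zero_right[OF mor_pow_in_Hom[OF f]] by simp
  then show ?thesis
    unfolding nilpotent_def fd[symmetric] using comp_in_Hom[OF d f] by blast
qed

end


section \<open>Dimensions in ribbon pseudotensor categories\<close>

context ribbon_pseudotensor_category
begin

section \<open>The given category as a category of arrows\<close>

lemma inverse_pair_iff: "inverse_pair C X Y f g \<longleftrightarrow> A.inverse_arrows (Arrow X f Y) (Arrow Y g X)"
  by (auto simp: inverse_pair_def A.inverse_arrows_Arrow)

lemma invertible_Arrow: "iso C X Y f \<Longrightarrow> A.invertible (Arrow X f Y)"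
  by (auto simp: iso_def inverse_pair_iff A.invertible_def)

lemma inv_arr_Arrow:
  assumes "iso C X Y f"
  shows "A.inv_arr (Arrow X f Y) = Arrow Y (inv_mor C X Y f) X"
proof -
  obtain g where g: "inverse_pair C X Y f g" using assms by (auto simp: iso_def)
  have "inv_mor C X Y f = g"
    unfolding inv_mor_def
  proof (rule the_equality)
    show "inverse_pair C X Y f g" by (rule g)
    fix h assume "inverse_pair C X Y f h"
    then have "Arrow Y h X = Arrow Y g X"
      using g unfolding inverse_pair_iff by (rule A.inverse_arrows_unique)
    then show "h = g" by simp
  qed
  then show ?thesis
    using g unfolding inverse_pair_iff by (simp add: A.inv_arr_eqI)
qed

definition atens :: "('o, 'm) hom_arrow \<Rightarrow> ('o, 'm) hom_arrow \<Rightarrow> ('o, 'm) hom_arrow" where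
  "atens u v = (if A.harr u \<and> A.harr v then
     Arrow (source u \<otimes> source v) (label u \<otimes>\<^sub>m label v) (target u \<otimes> target v) else Null)"

definition aass :: "'o \<Rightarrow> 'o \<Rightarrow> 'o \<Rightarrow> ('o, 'm) hom_arrow" where
  "aass X Y Z = Arrow ((X \<otimes> Y) \<otimes> Z) (assoc C X Y Z) (X \<otimes> (Y \<otimes> Z))"

definition alun :: "'o \<Rightarrow> ('o, 'm) hom_arrow" where
  "alun X = Arrow (unit_obj C \<otimes> X) (lunit C X) X"

definition arun :: "'o \<Rightarrow> ('o, 'm) hom_arrow" where
  "arun X = Arrow (X \<otimes> unit_obj C) (runit C X) X"

definition abr :: "'o \<Rightarrow> 'o \<Rightarrow> ('o, 'm) hom_arrow" where
  "abr X Y = Arrow (X \<otimes> Y) (braid C X Y) (Y \<otimes> X)"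

definition atw :: "'o \<Rightarrow> ('o, 'm) hom_arrow" where
  "atw X = Arrow X (twist C X) X"

definition aevl :: "'o \<Rightarrow> ('o, 'm) hom_arrow" where
  "aevl X = Arrow (dual C X \<otimes> X) (ev C X) (unit_obj C)"

definition acvl :: "'o \<Rightarrow> ('o, 'm) hom_arrow" where
  "acvl X = Arrow (unit_obj C) (coev C X) (X \<otimes> dual C X)"

lemma harr_atens [simp]: "A.harr (atens u v) \<longleftrightarrow> A.harr u \<and> A.harr v"
  by (auto simp: atens_def tensor_in_Hom elim!: A.harrE)

lemma atens_simps [simp]:
  assumes "A.harr u" "A.harr v"
  shows "source (atens u v) = source u \<otimes> source v" "target (atens u v) = target u \<otimes> target v"
    "label (atens u v) = label u \<otimes>\<^sub>m label v"
  using assms by (simp_all add: atens_def)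

lemma iso_in_Hom: "iso C X Y f \<Longrightarrow> f \<in> Hom C X Y"
  by (auto simp: iso_def inverse_pair_def)

lemma structure_arrow_simps [simp]:
  "A.harr (aass X Y Z)" "source (aass X Y Z) = (X \<otimes> Y) \<otimes> Z" "target (aass X Y Z) = X \<otimes> (Y \<otimes> Z)"
  "label (aass X Y Z) = assoc C X Y Z"
  "A.harr (alun X)" "source (alun X) = unit_obj C \<otimes> X" "target (alun X) = X" "label (alun X) = lunit C X"
  "A.harr (arun X)" "source (arun X) = X \<otimes> unit_obj C" "target (arun X) = X" "label (arun X) = runit C X"
  "A.harr (abr X Y)" "source (abr X Y) = X \<otimes> Y" "target (abr X Y) = Y \<otimes> X" "label (abr X Y) = braid C X Y"
  "A.harr (atw X)" "source (atw X) = X" "target (atw X) = X" "label (atw X) = twist C X"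
  "A.harr (aevl X)" "source (aevl X) = dual C X \<otimes> X" "target (aevl X) = unit_obj C" "label (aevl X) = ev C X"
  "A.harr (acvl X)" "source (acvl X) = unit_obj C" "target (acvl X) = X \<otimes> dual C X" "label (acvl X) = coev C X"
  "label (A.hident X) = idm C X"
  using assoc_iso lunit_iso runit_iso braid_iso twist_iso ev_in_Hom coev_in_Hom
  by (simp_all add: aass_def alun_def arun_def abr_def atw_def aevl_def acvl_def A.hident_def iso_in_Hom)

lemma structure_arrow_invertible [simp]:
  "A.invertible (aass X Y Z)" "A.invertible (alun X)" "A.invertible (arun X)" "A.invertible (abr X Y)"
  using assoc_iso lunit_iso runit_iso braid_iso
  by (simp_all add: aass_def alun_def arun_def abr_def invertible_Arrow)

lemma label_inv_aass:
  "label (A.inv_arr (aass X Y Z)) = assoc_inv C X Y Z"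
  by (simp add: aass_def inv_arr_Arrow[OF assoc_iso])

sublocale A: monoidal_arrows A.harr source target A.hcomp A.hident "(\<otimes>)" atens "unit_obj C" aass alun arun
proof
  show "A.hcomp (atens f' g') (atens f g) = atens (A.hcomp f' f) (A.hcomp g' g)"
    if "A.harr f" "A.harr f'" "A.harr g" "A.harr g'" "source f' = target f" "source g' = target g"
    for f f' g g'
    using that by (intro A.hom_arrow_eqI) (auto simp: tensor_comp elim!: A.harrE)
  show "A.hcomp (aass (target f) (target g) (target h)) (atens (atens f g) h) =
      A.hcomp (atens f (atens g h)) (aass (source f) (source g) (source h))"
    if "A.harr f" "A.harr g" "A.harr h" for f g h
    using that by (intro A.hom_arrow_eqI) (auto simp: assoc_natural elim!: A.harrE)
  show "A.hcomp (alun (target f)) (atens (A.hident (unit_obj C)) f) = A.hcomp f (alun (source f))"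
    if "A.harr f" for f
    using that by (intro A.hom_arrow_eqI) (auto simp: lunit_natural elim!: A.harrE)
  show "A.hcomp (arun (target f)) (atens f (A.hident (unit_obj C))) = A.hcomp f (arun (source f))"
    if "A.harr f" for f
    using that by (intro A.hom_arrow_eqI) (auto simp: runit_natural elim!: A.harrE)
qed (auto intro!: A.hom_arrow_eqI simp: tensor_id pentagon triangle)

text \<open>\<open>hexagon2\<close> solved for the braiding of a tensor product, by cancelling the
  inverse associators on both sides of it.\<close>

lemma abr_tensor_left:
  "abr (X \<otimes> Y) Z = A.hcomp (aass Z X Y) (A.hcomp (atens (abr X Z) (A.hident Y))
     (A.hcomp (A.inv_arr (aass X Z Y)) (A.hcomp (atens (A.hident X) (abr Y Z)) (aass X Y Z))))"
proof -
  let ?a = "aass Z X Y" and ?b = "aass X Y Z"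
  let ?r = "A.hcomp (atens (abr X Z) (A.hident Y)) (A.hcomp (A.inv_arr (aass X Z Y)) (atens (A.hident X) (abr Y Z)))"
  have "A.hcomp (A.inv_arr ?a) (A.hcomp (abr (X \<otimes> Y) Z) (A.inv_arr ?b)) = ?r"
    by (rule A.hom_arrow_eqI) (simp_all add: label_inv_aass hexagon2)
  then have "A.hcomp ?a (A.hcomp (A.hcomp (A.inv_arr ?a) (A.hcomp (abr (X \<otimes> Y) Z) (A.inv_arr ?b))) ?b)
     = A.hcomp ?a (A.hcomp ?r ?b)"
    by simp
  then show ?thesis by (simp add: A.comp_assoc)
qed

sublocale A: ribbon_arrows A.harr source target A.hcomp A.hident "(\<otimes>)" atens "unit_obj C" aass alun arun
  abr atw "dual C" aevl acvl
proof
  show "A.hcomp (abr X' Y') (atens f g) = A.hcomp (atens g f) (abr X Y)"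
    if "A.harr f" "A.harr g" "X = source f" "X' = target f" "Y = source g" "Y' = target g"
    for f g X X' Y Y'
    using that by (intro A.hom_arrow_eqI) (auto simp: braid_natural elim!: A.harrE)
  show "A.hcomp (atw Y) f = A.hcomp f (atw X)" if "A.harr f" "X = source f" "Y = target f" for f X Y
    using that by (intro A.hom_arrow_eqI) (auto simp: twist_natural elim!: A.harrE)
qed (auto intro!: A.hom_arrow_eqI abr_tensor_left simp: hexagon1 twist_tensor zigzag1)

section \<open>Endomorphisms of the unit as scalars, and additivity of the trace\<close>

lemma scalar_of_eqI: "scale C k (idm C (unit_obj C)) = f \<Longrightarrow> scalar_of C f = k"
  unfolding scalar_of_def using End_unit by (auto simp: bij_betw_def inj_on_def)

lemma scale_scalar_of:
  assumes "f \<in> Hom C (unit_obj C) (unit_obj C)"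
  shows "scale C (scalar_of C f) (idm C (unit_obj C)) = f"
proof -
  obtain k where "f = scale C k (idm C (unit_obj C))"
    using assms End_unit by (auto simp: bij_betw_def)
  then show ?thesis using scalar_of_eqI by metis
qed

lemma scalar_of_add:
  assumes "f \<in> Hom C (unit_obj C) (unit_obj C)" "g \<in> Hom C (unit_obj C) (unit_obj C)"
  shows "scalar_of C (f + g) = scalar_of C f + scalar_of C g"
  by (rule scalar_of_eqI) (simp add: V.scale_left_distrib scale_scalar_of assms)

lemma scalar_of_comp:
  assumes "f \<in> Hom C (unit_obj C) (unit_obj C)" "g \<in> Hom C (unit_obj C) (unit_obj C)"
  shows "scalar_of C (f \<cdot> g) = scalar_of C f * scalar_of C g"
proof (rule scalar_of_eqI)
  have "f \<cdot> g = scale C (scalar_of C f) (idm C (unit_obj C)) \<cdot> g"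
    by (simp add: scale_scalar_of assms)
  also have "\<dots> = scale C (scalar_of C f) (scale C (scalar_of C g) (idm C (unit_obj C)))"
    by (simp only: comp_scale_left[OF assms(2) id_in_Hom] comp_id_left[OF assms(2)] scale_scalar_of[OF assms(2)])
  finally show "scale C (scalar_of C f * scalar_of C g) (idm C (unit_obj C)) = f \<cdot> g"
    by simp
qed

lemma scalar_of_mor_pow:
  assumes "f \<in> Hom C (unit_obj C) (unit_obj C)"
  shows "scalar_of C (mor_pow C (unit_obj C) f k) = scalar_of C f ^ k"
proof (induction k)
  case 0
  then show ?case by (simp add: scalar_of_eqI)
next
  case (Suc k)
  then show ?case by (simp add: scalar_of_comp[OF assms mor_pow_in_Hom[OF assms]])
qed

lemma twist_in_Hom: "twist C X \<in> Hom C X X"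
  using twist_iso iso_in_Hom by blast

lemma cat_trace_add:
  assumes "f \<in> Hom C X X" "g \<in> Hom C X X"
  shows "cat_trace C X (f + g) = cat_trace C X f + cat_trace C X g"
proof -
  let ?d = "dual C X"
  let ?h = "\<lambda>f. ((twist C X \<cdot> f) \<otimes>\<^sub>m idm C ?d) \<cdot> coev C X"
  have t: "twist C X \<cdot> f \<in> Hom C X X" if "f \<in> Hom C X X" for f
    using that twist_in_Hom by (rule comp_in_Hom)
  have h: "?h f \<in> Hom C (unit_obj C) (X \<otimes> ?d)" if "f \<in> Hom C X X" for f
    by (rule comp_in_Hom[OF coev_in_Hom tensor_in_Hom[OF t[OF that] id_in_Hom]])
  have b: "braid C X ?d \<cdot> ?h f \<in> Hom C (unit_obj C) (?d \<otimes> X)" if "f \<in> Hom C X X" for f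
    by (rule comp_in_Hom[OF h[OF that] iso_in_Hom[OF braid_iso]])
  have "?h (f + g) = ?h f + ?h g"
    by (simp add: comp_add_right[OF assms twist_in_Hom] tensor_add_left[OF t[OF assms(1)] t[OF assms(2)] id_in_Hom]
        comp_add_left[OF coev_in_Hom tensor_in_Hom[OF t[OF assms(1)] id_in_Hom] tensor_in_Hom[OF t[OF assms(2)] id_in_Hom]])
  then have "ev C X \<cdot> braid C X ?d \<cdot> ?h (f + g) = (ev C X \<cdot> braid C X ?d \<cdot> ?h f) + (ev C X \<cdot> braid C X ?d \<cdot> ?h g)"
    by (simp only: comp_add_right[OF h[OF assms(1)] h[OF assms(2)] iso_in_Hom[OF braid_iso]]
        comp_add_right[OF b[OF assms(1)] b[OF assms(2)] ev_in_Hom])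
  then show ?thesis
    unfolding cat_trace_def
    using scalar_of_add[OF comp_in_Hom[OF b[OF assms(1)] ev_in_Hom] comp_in_Hom[OF b[OF assms(2)] ev_in_Hom]]
    by simp
qed

section \<open>Returning from the strictification to the given category\<close>

text \<open>The label of a strict arrow is an arrow of the given category with endpoints; the label
  of that is the morphism itself.\<close>

lemma label_label_in_Hom:
  assumes "A.S.harr u" "source u = x" "target u = y"
  shows "label (label u) \<in> Hom C (A.lobj x) (A.lobj y)"
  using A.label_simps[OF assms(1)] assms(2,3) by (auto elim!: A.harrE)

lemma label_label_arr_pow:
  assumes "A.S.harr u" "source u = x" "target u = x"
  shows "label (label (A.S.arr_pow u k)) = mor_pow C (A.lobj x) (label (label u)) k"
  using assms by (induction k) simp_all

lemma scalar_of_tr: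
  assumes "A.S.harr u" "source u = x" "target u = x"
  shows "scalar_of C (label (label (A.S.tr x u))) = cat_trace C (A.lobj x) (label (label u))"
  using assms by (simp add: A.label_tr cat_trace_def)

lemma cat_dim_lobj: "cat_dim C (A.lobj x) = scalar_of C (label (label (A.S.tr x (A.S.hident x))))"
  by (simp add: scalar_of_tr cat_dim_def)

lemma cat_dim_lobj_lpow: "cat_dim C (A.lobj (lpow x (Suc k))) = cat_dim C (A.lobj x) ^ Suc k"
proof -
  let ?t = "A.S.tr x (A.S.hident x)"
  have "label (label ?t) \<in> Hom C (unit_obj C) (unit_obj C)"
    using label_label_in_Hom[of ?t "[]" "[]"] by simp
  then show ?thesis
    unfolding cat_dim_lobj A.S.tr_ident_lpow
    using scalar_of_mor_pow label_label_arr_pow[of ?t "[]" "Suc k"]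
    by (simp del: A.S.arr_pow.simps mor_pow.simps power_Suc)
qed

section \<open>Consequences of the vanishing of nilpotent traces\<close>

context
  assumes nilpotent_trace: "\<And>X f. nilpotent C X f \<Longrightarrow> cat_trace C X f = 0"
begin

lemma cat_trace_cong_nilpotent:
  assumes "f \<in> Hom C X X" "g \<in> Hom C X X" "nilpotent C X (f - g)"
  shows "cat_trace C X f = cat_trace C X g"
  using cat_trace_add[OF diff_in_Hom[OF assms(1,2)] assms(2)] nilpotent_trace[OF assms(3)] by simp

lemma cat_trace_unipotent:
  assumes "f \<in> Hom C X X" "unipotent C X f"
  shows "cat_trace C X f = cat_dim C X"
  using cat_trace_cong_nilpotent[OF assms(1) id_in_Hom] assms(2) by (simp add: unipotent_def cat_dim_def)

theorem cat_dim_power_eq: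
  assumes unipotent_twist: "\<And>X. unipotent C X (mor_pow C X (twist C X) l)"
    and p: "prime CHAR('k)" and l: "l > 0" and m: "CHAR('k) ^ n = Suc (l * (l * r))" "r > 0"
  shows "cat_dim C V ^ (CHAR('k) ^ n) = cat_dim C V"
proof -
  obtain k where k: "l = Suc k" using l by (cases l) auto
  \<comment> \<open>The exponent q is \<open>l * r\<close>; \<open>j = q - 1\<close> is the number
    of copies of X that get closed, the remaining one being the block that moves.\<close>
  obtain j where j: "l * r = Suc j" using l m(2) by (cases "l * r") auto
  define N where "N = l * (l * r)"
  define x Y where "x = lpow [V] l" and "Y = lpow [V] (Suc N)"
  have N: "N = k + Suc (Suc k * j)" by (simp only: N_def j) (simp add: k)
  define g where "g = A.S.rot [V] (lpow [V] N)"
  have g [simp]: "A.S.harr g" "source g = Y" "target g = Y"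
    by (simp_all add: g_def Y_def lpow_append_commute[of "[V]", simplified])
  have gl [simp]: "A.S.harr (A.S.arr_pow g l)" "source (A.S.arr_pow g l) = Y" "target (A.S.arr_pow g l) = Y"
    by simp_all
  have gN: "A.S.arr_pow g (Suc N) = A.stw Y"
    unfolding g_def Y_def by (rule A.S.rot_pow_eq_tw)
  have glN: "A.S.arr_pow (A.S.arr_pow g l) (Suc N) = A.S.arr_pow (A.stw Y) l"
    using A.S.arr_pow_mult[of g l "Suc N"] A.S.arr_pow_mult[of g "Suc N" l]
    by (simp only: g gN mult.commute)
  have "mor_pow C (A.lobj Y) (label (label (A.S.arr_pow g l))) (Suc N) =
      label (label (A.S.arr_pow (A.S.arr_pow g l) (Suc N)))"
    by (rule label_label_arr_pow[OF gl, symmetric])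
  also have "\<dots> = mor_pow C (A.lobj Y) (twist C (A.lobj Y)) l"
    unfolding glN by (simp add: label_label_arr_pow)
  finally have "mor_pow C (A.lobj Y) (label (label (A.S.arr_pow g l))) (CHAR('k) ^ n) =
      mor_pow C (A.lobj Y) (twist C (A.lobj Y)) l"
    by (simp only: m(1) N_def)
  then have "unipotent C (A.lobj Y) (label (label (A.S.arr_pow g l)))"
    using unipotent_twist p
    by (intro unipotent_if_mor_pow_char_power[OF label_label_in_Hom[OF gl], where n = n]) simp_all
  then have "cat_dim C V ^ Suc N = cat_trace C (A.lobj Y) (label (label (A.S.arr_pow g l)))"
    using cat_trace_unipotent[OF label_label_in_Hom[OF gl]] cat_dim_lobj_lpow[of "[V]" N]
    by (simp add: Y_def)
  also have "\<dots> = scalar_of C (label (label (A.S.tr Y (A.S.arr_pow g l))))"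
    by (simp add: scalar_of_tr)
  also have "\<dots> = cat_dim C V"
  proof -
    \<comment> \<open>The twist here is the curl left by closing the single V. It starts the count
      at 1, so that closing the other l - 1 strands brings the exponent of v_V to exactly l.\<close>
    define \<delta> where "\<delta> = A.S.hcomp (A.sbr (lpow [V] k) [V]) (A.stens (A.S.hident (lpow [V] k)) (A.stw [V]))"
    have x: "x = lpow [V] k @ [V]" unfolding x_def k by (rule lpow_Suc2)
    have \<delta> [simp]: "A.S.harr \<delta>" "source \<delta> = x" "target \<delta> = x"
      by (simp_all add: \<delta>_def x lpow_append_commute[of "[V]", simplified])
    have tr: "A.S.tr Y (A.S.arr_pow g l) = A.S.tr x (A.S.hcomp \<delta> (A.S.arr_pow (A.stw x) (Suc j)))"
      unfolding Y_def g_def \<delta>_def x_def k by (rule A.S.tr_rot_pow[OF N])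
    let ?X = "A.lobj x" and ?d = "label (label \<delta>)"
    let ?u = "mor_pow C ?X (twist C ?X) (l * r)"
    have d: "?d \<in> Hom C ?X ?X" by (rule label_label_in_Hom) simp_all
    have u: "?u \<in> Hom C ?X ?X" by (intro mor_pow_in_Hom twist_in_Hom)
    have du: "?d \<cdot> ?u = ?u \<cdot> ?d"
      by (rule mor_pow_commute[OF twist_in_Hom d twist_natural[OF d], symmetric])
    have "unipotent C ?X ?u"
      by (rule unipotent_mor_pow_mult[OF twist_in_Hom unipotent_twist])
    then have "cat_trace C ?X (?d \<cdot> ?u) = cat_trace C ?X ?d"
      by (intro cat_trace_cong_nilpotent comp_in_Hom[OF u d] d nilpotent_comp_unipotent_diff[OF d u du])
    then have "scalar_of C (label (label (A.S.tr Y (A.S.arr_pow g l)))) = scalar_of C (label (label (A.S.tr x \<delta>)))"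
      unfolding tr j by (simp add: scalar_of_tr label_label_arr_pow del: A.S.arr_pow.simps mor_pow.simps)
    also have "A.S.tr x \<delta> = A.S.tr [V] (A.S.arr_pow (A.stw [V]) l)"
      using A.S.tr_br_lpow[of "[V]" k 1] by (simp add: \<delta>_def x_def k)
    also have "scalar_of C (label (label \<dots>)) = cat_trace C V (mor_pow C V (twist C V) l)"
      by (simp add: scalar_of_tr label_label_arr_pow)
    also have "\<dots> = cat_dim C V"
      by (rule cat_trace_unipotent[OF mor_pow_in_Hom[OF twist_in_Hom] unipotent_twist])
    finally show ?thesis .
  qed
  finally show ?thesis by (simp add: m(1) N_def)
qed

end

end

text \<open>Pigeonhole: two powers of \<open>a\<close> agree modulo \<open>b\<close>, and their
  common factor is cancelled by coprimality. This guarantees that the least exponent in the theorem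
  exists.\<close>

lemma exists_power_minus_1_dvd:
  fixes a b :: nat
  assumes "coprime a b" "b > 0"
  shows "\<exists>m>0. b dvd a ^ m - 1"
proof -
  have "\<not> inj (\<lambda>i. a ^ i mod b)"
  proof
    assume "inj (\<lambda>i. a ^ i mod b)"
    moreover have "range (\<lambda>i. a ^ i mod b) \<subseteq> {..<b}" using assms(2) by auto
    ultimately show False
      using finite_subset finite_imageD infinite_UNIV_nat by blast
  qed
  then obtain i j where "a ^ i mod b = a ^ j mod b" "i < j"
    unfolding inj_def by (metis linorder_neqE_nat)
  then have "b dvd a ^ j - a ^ i"
    by (metis mod_eq_dvd_iff_nat nat_le_linear diff_is_0_eq dvd_0_right)
  also have "a ^ j - a ^ i = a ^ i * (a ^ (j - i) - 1)"
    using \<open>i < j\<close> by (simp add: diff_mult_distrib2 flip: power_add)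
  finally have "b dvd a ^ (j - i) - 1"
    using assms(1) by (simp add: coprime_dvd_mult_right_iff coprime_commute)
  then show ?thesis using \<open>i < j\<close> by (intro exI[of _ "j - i"]) simp
qed

theorem theorem5p15:
  fixes C :: "('o, 'm::ab_group_add, 'k::alg_closed_field) ribbon_category"
    and p l n :: nat and V :: 'o
  assumes "CHAR('k) = p" and "p > 0"
    and "ribbon_pseudotensor_category C"
    and "\<And>X f. nilpotent C X f \<Longrightarrow> cat_trace C X f = 0"
    and "l > 0" and "coprime l p"
    and "\<And>X. unipotent C X (mor_pow C X (twist C X) l)"
    and "n = (LEAST m. m > 0 \<and> l ^ 2 dvd p ^ m - 1)"
  shows "cat_dim C V \<in> finite_subfield (p ^ n)"
proof -
  interpret ribbon_pseudotensor_category C by (rule assms)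
  have p: "prime p" using assms(1,2) prime_CHAR_semidom[where ?'a = 'k] by simp
  have "\<exists>m>0. l ^ 2 dvd p ^ m - 1"
    using assms(5,6) by (intro exists_power_minus_1_dvd) (auto simp: coprime_commute)
  then have n: "n > 0" "l ^ 2 dvd p ^ n - 1"
    unfolding assms(8) by (metis (mono_tags, lifting) LeastI_ex)+
  \<comment> \<open>This undoes the truncated subtraction and forces the cofactor \<open>r\<close>
    to be positive.\<close>
  have "p ^ n > 1" using one_less_power[OF prime_gt_1_nat[OF p] n(1)] .
  moreover obtain r where r: "p ^ n - 1 = l ^ 2 * r" using n(2) by (rule dvdE)
  ultimately have "p ^ n = Suc (l * (l * r))" "r > 0"
    by (auto simp: power2_eq_square mult.assoc intro!: gr0I)
  then have "cat_dim C V ^ (p ^ n) = cat_dim C V"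
    using cat_dim_power_eq[of l n r V] assms p by simp
  \<comment> \<open>The subfield with p^n elements is the fixed set of the n-th power of Frobenius,
    so the equation just obtained is membership.\<close>
  then show ?thesis
    using finite_subfield_eq[OF assms(1,2) n(1)] by simp
qed

end
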